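(* Let $n$ be a positive integer and let $A$ and $B$ be $2n\times 2n$ complex matrices satisfying $$\operatorname{rank}(A:B)=2n\quad\text{and}\quad AC_{2n}A^*=BC_{2n}B^*.$$ Let $Z$ be the $4n\times 4n$ matrix $$Z=\frac1{\sqrt2}\begin{pmatrix} I_n&I_n&0&0\\ I_n&-I_n&0&0\\ 0&0&I_n&I_n\\ 0&0&I_n&-I_n\end{pmatrix}\begin{pmatrix} I_n&0&0&0\\ 0&(-1)^{n+1}iC_n&0&0\\ 0&0&I_n&0\\ 0&0&0&(-1)^{n+1}iC_n\end{pmatrix}.$$ Then there exist a $2n\times 2n$ non-singular complex matrix $U$, $n\times n$ unitary matrices $V_1,U_1^*,U_2^*,V_2$, and $n\times n$ positive semi-definite diagonal matrices $C$ and $S$ with $C^2+S^2=I_n$, such that $$(A:B)=U\begin{pmatrix} C&I_n&0&S\\ -S&0&I_n&C\end{pmatrix}\begin{pmatrix} V_1&0&0&0\\ 0&U_1^*&0&0\\ 0&0&U_2^*&0\\ 0&0&0&V_2\end{pmatrix}Z,$$ and the boundary conditions $AY(a)+BY(b)=0$ are (1) separated, if and only if $S=0$; (2) mixed, if and only if $0<\operatorname{rank}(S)<n$; (3) coupled, if and only if $\operatorname{rank}(S)=n$.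
   Context: For matrices $A,B$ with the same number of rows, $(A:B)$ denotes the block matrix obtained by placing $A$ and $B$ side by side. $M^*$ denotes the conjugate transpose of $M$, $I_m$ is the $m\times m$ identity matrix, and $i$ is the imaginary unit. For a positive integer $m$, $C_m=\left((-1)^r\delta_{r,m+1-s}\right)_{r,s=1}^m$, where $\delta$ is the Kronecker delta; in particular $C_{2n}=\left((-1)^r\delta_{r,2n+1-s}\right)_{r,s=1}^{2n}$. (The symbol $C$ without subscript is a different matrix, as introduced in the claim.) Here $Y=(y^{[0]},\ldots,y^{[2n-1]})^{\top}$ is the vector of quasi-derivatives of a function $y$ on an interval $(a,b)$, $-\infty\le a<b\le\infty$, associated with a $2n$-th order differential equation, and the pair $(A,B)$ encodes the boundary conditions $AY(a)+BY(b)=0$. If $\operatorname{rank}(A:B)=2n$ and $AC_{2n}A^*=BC_{2n}B^*$, then $\operatorname{rank}A=\operatorname{rank}B=n+r$ for some $r\in\{0,1,\ldots,n\}$. For such $(A,B)$ the boundary conditions are by definition: separated if $r=0$; mixed if $0<r<n$; coupled if $r=n$. Thus the type depends only on the common rank of $A$ and $B$. *)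

theory Defs
  imports
    Complex_Main
    "Jordan_Normal_Form.DL_Rank"
    "Jordan_Normal_Form.Schur_Decomposition"
begin

definition side_by_side :: "complex mat \<Rightarrow> complex mat \<Rightarrow> complex mat" where
  "side_by_side A B =
     four_block_mat A B (0\<^sub>m 0 (dim_col A)) (0\<^sub>m 0 (dim_col B))"

text \<open>
  Matrices are indexed from 0, so the 1-based row and column numbers of the
  entry at position \<open>(r, s)\<close> are \<open>Suc r\<close> and \<open>Suc s\<close>.
\<close>

definition C_mat :: "nat \<Rightarrow> complex mat" where
  "C_mat m = mat m m (\<lambda>(r, s). if Suc r = m + 1 - Suc s then (- 1) ^ Suc r else 0)"

definition unitary_mat :: "nat \<Rightarrow> complex mat \<Rightarrow> bool" where
  "unitary_mat m U \<longleftrightarrow> U \<in> carrier_mat m m \<and>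
     mat_adjoint U * U = 1\<^sub>m m \<and> U * mat_adjoint U = 1\<^sub>m m"

text \<open>
  The order on \<open>complex\<close> is the one in which \<open>0 \<le> z\<close> says that \<open>z\<close> is real and
  nonnegative; \<open>(P *\<^sub>v v) \<bullet>c v\<close> is \<open>v\<^sup>* P v\<close>.
\<close>

definition pos_semidef_mat :: "nat \<Rightarrow> complex mat \<Rightarrow> bool" where
  "pos_semidef_mat m P \<longleftrightarrow> P \<in> carrier_mat m m \<and> mat_adjoint P = P \<and>
     (\<forall>v \<in> carrier_vec m. 0 \<le> (P *\<^sub>v v) \<bullet>c v)"

definition Z_mat :: "nat \<Rightarrow> complex mat" where
  "Z_mat n =
     (let H = four_block_mat (1\<^sub>m n) (1\<^sub>m n) (1\<^sub>m n) (- 1\<^sub>m n);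
          D = ((- 1) ^ (n + 1) * \<i>) \<cdot>\<^sub>m C_mat n
      in complex_of_real (1 / sqrt 2) \<cdot>\<^sub>m
           (diag_block_mat [H, H] * diag_block_mat [1\<^sub>m n, D, 1\<^sub>m n, D]))"

definition CS_block_mat :: "nat \<Rightarrow> complex mat \<Rightarrow> complex mat \<Rightarrow> complex mat" where
  "CS_block_mat n C S =
     side_by_side
       (four_block_mat C     (1\<^sub>m n)
                       (- S) (0\<^sub>m n n))
       (four_block_mat (0\<^sub>m n n) S
                       (1\<^sub>m n)   C)"

text \<open>
  The pair \<open>(A, B)\<close> of \<open>2n \<times> 2n\<close> matrices stands for the boundary conditions
  \<open>A Y(a) + B Y(b) = 0\<close>, whose type depends on the common rank \<open>n + r\<close> of
  \<open>A\<close> and \<open>B\<close> only. The type is meant for pairs with \<open>rank (A : B) = 2n\<close> and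
  \<open>A C\<^sub>2\<^sub>n A\<^sup>* = B C\<^sub>2\<^sub>n B\<^sup>*\<close>, for which there is such an \<open>r \<in> {0..n}\<close>.
\<close>

definition common_rank :: "nat \<Rightarrow> complex mat \<Rightarrow> complex mat \<Rightarrow> nat \<Rightarrow> bool" where
  "common_rank n A B r \<longleftrightarrow>
     vec_space.rank (2 * n) A = n + r \<and> vec_space.rank (2 * n) B = n + r"

definition separated_bc :: "nat \<Rightarrow> complex mat \<Rightarrow> complex mat \<Rightarrow> bool" where
  "separated_bc n A B \<longleftrightarrow> common_rank n A B 0"

definition mixed_bc :: "nat \<Rightarrow> complex mat \<Rightarrow> complex mat \<Rightarrow> bool" where
  "mixed_bc n A B \<longleftrightarrow> (\<exists>r. 0 < r \<and> r < n \<and> common_rank n A B r)"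

definition coupled_bc :: "nat \<Rightarrow> complex mat \<Rightarrow> complex mat \<Rightarrow> bool" where
  "coupled_bc n A B \<longleftrightarrow> common_rank n A B n"

end

theory Submission
  imports Defs "Jordan_Normal_Form.Spectral_Radius" "Jordan_Normal_Form.Matrix_Kernel"
begin

text \<open>
  The matrix \<open>Z\<close> is \<open>diag(W, W)\<close> with a unitary \<open>W\<close>, and \<open>W\<close> diagonalizes the form of the boundary value problem:
  \<open>C\<^sub>2\<^sub>n = i (-1)\<^sup>n W\<^sup>* diag(I, -I) W\<close> (lemma \<open>C_mat_double_eq\<close>). In the coordinates \<open>A W\<^sup>* = (A1 : A2)\<close> and
  \<open>B W\<^sup>* = (B1 : B2)\<close> the condition \<open>A C\<^sub>2\<^sub>n A\<^sup>* = B C\<^sub>2\<^sub>n B\<^sup>*\<close> therefore becomes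
  \<open>A1 A1\<^sup>* + B2 B2\<^sup>* = A2 A2\<^sup>* + B1 B1\<^sup>*\<close>, that is \<open>P P\<^sup>* = Q Q\<^sup>*\<close> for \<open>P = (A1 : B2)\<close> and \<open>Q = (A2 : B1)\<close>.
  The rank condition makes \<open>P P\<^sup>* + Q Q\<^sup>* = A A\<^sup>* + B B\<^sup>*\<close> nonsingular, so \<open>P\<close> and \<open>Q\<close> are invertible and
  \<open>Y = Q\<inverse> P\<close> is a unitary matrix of size \<open>2n\<close>.

  All that is left is the CS decomposition of \<open>Y\<close> in four blocks of size \<open>n\<close>,
  \<open>Y = diag(U1, U2) (C, S; -S, C) diag(V1, V2)\<close> (theorem \<open>cs_decomposition\<close>; semicolons separate block rows).
  With \<open>U = Q diag(U1, U2)\<close> the identities \<open>Q = U diag(U1\<^sup>*, U2\<^sup>*)\<close> and \<open>P = U (C, S; -S, C) diag(V1, V2)\<close>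
  are the asserted factorization, with its block columns in a different order
  (lemma \<open>boundary_pair_decomposition\<close>). The CS decomposition itself rests on the spectral theorem for Hermitian
  matrices and on lemma \<open>orthogonal_columns_factor\<close>, by which a matrix with orthogonal columns is
  unitary times diagonal even when some columns vanish.

  The type of the boundary conditions is read off from the factorization: up to invertible factors on both sides,
  \<open>A\<close> and \<open>B\<close> are both \<open>diag(I, S)\<close>, so their common rank is \<open>n + rank S\<close> (lemma \<open>rank_cs_factors\<close>).
\<close>

section \<open>Adjoints\<close>

lemma adjoint_dim [simp]:
  "dim_row (mat_adjoint A) = dim_col A" "dim_col (mat_adjoint A) = dim_row A"
  unfolding mat_adjoint_def by auto

lemma adjoint_carrier_iff [simp]: "mat_adjoint A \<in> carrier_mat c r \<longleftrightarrow> A \<in> carrier_mat r c"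
  unfolding carrier_mat_def by (simp add: conj_commute)

lemma adjoint_index [simp]:
  "i < dim_col A \<Longrightarrow> j < dim_row A \<Longrightarrow> mat_adjoint A $$ (i, j) = conjugate (A $$ (j, i))"
  unfolding mat_adjoint_def by (simp add: mat_of_rows_index)

lemma adjoint_adjoint [simp]: "mat_adjoint (mat_adjoint A) = A"
  by (rule eq_matI) auto

lemma adjoint_zero [simp]: "mat_adjoint (0\<^sub>m r c :: complex mat) = 0\<^sub>m c r"
  by (rule eq_matI) auto

lemma adjoint_one [simp]: "mat_adjoint (1\<^sub>m n :: complex mat) = 1\<^sub>m n"
  by (rule eq_matI) auto

lemma adjoint_uminus [simp]: "mat_adjoint (- A :: complex mat) = - mat_adjoint A"
  by (rule eq_matI) auto

lemma adjoint_smult: "mat_adjoint (k \<cdot>\<^sub>m A :: complex mat) = cnj k \<cdot>\<^sub>m mat_adjoint A"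
  by (rule eq_matI) auto

lemma adjoint_add:
  "A \<in> carrier_mat r c \<Longrightarrow> B \<in> carrier_mat r c \<Longrightarrow>
   mat_adjoint (A + B :: complex mat) = mat_adjoint A + mat_adjoint B"
  by (rule eq_matI) auto

lemma adjoint_mult:
  fixes A B :: "complex mat"
  assumes "A \<in> carrier_mat r k" "B \<in> carrier_mat k c"
  shows "mat_adjoint (A * B) = mat_adjoint B * mat_adjoint A"
  using assms
  by (intro eq_matI) (auto simp: scalar_prod_def mult.commute intro!: sum.cong)

lemma adjoint_four_block:
  fixes A B C D :: "complex mat"
  assumes "A \<in> carrier_mat r1 c1" "B \<in> carrier_mat r1 c2"
    "C \<in> carrier_mat r2 c1" "D \<in> carrier_mat r2 c2"
  shows "mat_adjoint (four_block_mat A B C D) =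
    four_block_mat (mat_adjoint A) (mat_adjoint C) (mat_adjoint B) (mat_adjoint D)"
  using assms by (intro eq_matI) auto

text \<open>
  If \<open>M\<^sup>* M v = 0\<close> then \<open>\<parallel>M v\<parallel>\<^sup>2 = \<langle>M\<^sup>* M v, v\<rangle> = 0\<close>. This turns statements about the Gram matrix
  of \<open>M\<close> into statements about \<open>M\<close> itself.
\<close>

lemma gram_mult_vec_eq_0D:
  fixes M :: "complex mat"
  assumes M: "M \<in> carrier_mat r c" and v: "v \<in> carrier_vec c"
    and eq: "(mat_adjoint M * M) *\<^sub>v v = 0\<^sub>v c"
  shows "M *\<^sub>v v = 0\<^sub>v r"
proof -
  define w where "w = M *\<^sub>v v"
  have w: "w \<in> carrier_vec r" using M v by (simp add: w_def)
  have "mat_adjoint M *\<^sub>v w = 0\<^sub>v c"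
    using eq M v unfolding w_def by (subst assoc_mult_mat_vec[symmetric]) auto
  have sw: "(\<Sum>j<c. M $$ (i, j) * v $ j) = w $ i" if "i < r" for i
    using that M v by (auto simp: w_def scalar_prod_def lessThan_atLeast0 intro!: sum.cong)
  have aw: "(\<Sum>i<r. cnj (M $$ (i, j)) * w $ i) = 0" if "j < c" for j
  proof -
    have "(mat_adjoint M *\<^sub>v w) $ j = 0"
      using \<open>mat_adjoint M *\<^sub>v w = 0\<^sub>v c\<close> that by simp
    moreover have "(mat_adjoint M *\<^sub>v w) $ j = (\<Sum>i<r. cnj (M $$ (i, j)) * w $ i)"
      using that M w by (auto simp: scalar_prod_def lessThan_atLeast0 intro!: sum.cong)
    ultimately show ?thesis by simp
  qed
  have "w \<bullet>c w = (\<Sum>i<r. w $ i * cnj (\<Sum>j<c. M $$ (i, j) * v $ j))"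
    using w sw by (auto simp: scalar_prod_def lessThan_atLeast0 intro!: sum.cong)
  also have "\<dots> = (\<Sum>i<r. \<Sum>j<c. cnj (v $ j) * (cnj (M $$ (i, j)) * w $ i))"
    by (auto simp: sum_distrib_left intro!: sum.cong)
  also have "\<dots> = (\<Sum>j<c. cnj (v $ j) * (\<Sum>i<r. cnj (M $$ (i, j)) * w $ i))"
    unfolding sum_distrib_left by (rule sum.swap)
  also have "\<dots> = 0" using aw by simp
  finally show ?thesis using w unfolding w_def by simp
qed

section \<open>Inverses and unitary matrices\<close>

lemma det_nonzero_obtain_inverse:
  fixes A :: "complex mat"
  assumes "A \<in> carrier_mat n n" "det A \<noteq> 0"
  obtains B where "B \<in> carrier_mat n n" "A * B = 1\<^sub>m n" "B * A = 1\<^sub>m n"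
  using det_non_zero_imp_unit[OF assms, of undefined] unfolding Units_def
  by (auto simp: ring_mat_simps)

lemma det_adjoint_eq_0:
  fixes A :: "complex mat"
  assumes A: "A \<in> carrier_mat n n" and "det A = 0"
  shows "det (mat_adjoint A) = 0"
proof (rule ccontr)
  assume "det (mat_adjoint A) \<noteq> 0"
  then obtain B where B: "B \<in> carrier_mat n n" "mat_adjoint A * B = 1\<^sub>m n"
    using det_nonzero_obtain_inverse[of "mat_adjoint A" n] A by auto
  have "mat_adjoint B * A = mat_adjoint (mat_adjoint A * B)"
    using A B(1) by (simp add: adjoint_mult[of _ n n _ n])
  then have "mat_adjoint B * A = 1\<^sub>m n" using B(2) by simp
  moreover have "det (mat_adjoint B * A) = det (mat_adjoint B) * det A"
    using A B(1) by (intro det_mult) auto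
  ultimately show False using \<open>det A = 0\<close> by simp
qed

lemma invertible_matI:
  fixes A :: "complex mat"
  assumes "A \<in> carrier_mat n n" "B \<in> carrier_mat n n" "A * B = 1\<^sub>m n"
  shows "invertible_mat A"
  using assms mat_mult_left_right_inverse[OF assms] unfolding invertible_mat_def inverts_mat_def by auto

lemma invertible_mat_obtain_inverse:
  fixes A :: "complex mat"
  assumes "A \<in> carrier_mat n n" "invertible_mat A"
  obtains B where "B \<in> carrier_mat n n" "A * B = 1\<^sub>m n" "B * A = 1\<^sub>m n"
proof -
  obtain B where B: "A * B = 1\<^sub>m n" "B * A = 1\<^sub>m (dim_row B)"
    using assms by (auto simp: invertible_mat_def inverts_mat_def)
  then have "B \<in> carrier_mat n n"
    using assms(1) by (metis carrier_matD(2) carrier_matI index_mult_mat(3) index_one_mat(2,3))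
  then show thesis using that B by simp
qed

lemma invertible_mat_mult:
  fixes A B :: "complex mat"
  assumes "A \<in> carrier_mat n n" "B \<in> carrier_mat n n" "invertible_mat A" "invertible_mat B"
  shows "invertible_mat (A * B)"
proof -
  obtain A' where A': "A' \<in> carrier_mat n n" "A * A' = 1\<^sub>m n"
    using invertible_mat_obtain_inverse assms by metis
  obtain B' where B': "B' \<in> carrier_mat n n" "B * B' = 1\<^sub>m n"
    using invertible_mat_obtain_inverse assms by metis
  have "(A * B) * (B' * A') = A * ((B * B') * A')"
    using assms A'(1) B'(1) by (simp add: assoc_mult_mat[of _ n n _ n _ n])
  also have "\<dots> = 1\<^sub>m n" using A' B'(2) by simp
  finally show ?thesis using assms A' B' by (intro invertible_matI[of _ n "B' * A'"]) auto
qed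

lemma unitary_matI:
  assumes "Q \<in> carrier_mat n n" "mat_adjoint Q * Q = 1\<^sub>m n"
  shows "unitary_mat n Q"
  using assms mat_mult_left_right_inverse[of "mat_adjoint Q" n Q] unfolding unitary_mat_def by simp

lemma unitary_matD:
  assumes "unitary_mat n Q"
  shows "Q \<in> carrier_mat n n" "mat_adjoint Q \<in> carrier_mat n n"
    "mat_adjoint Q * Q = 1\<^sub>m n" "Q * mat_adjoint Q = 1\<^sub>m n"
  using assms unfolding unitary_mat_def by auto

lemma unitary_mat_adjoint: "unitary_mat n Q \<Longrightarrow> unitary_mat n (mat_adjoint Q)"
  unfolding unitary_mat_def by auto

lemma unitary_cancel:
  assumes "unitary_mat n Q" "M \<in> carrier_mat n c"
  shows "mat_adjoint Q * (Q * M) = M" "Q * (mat_adjoint Q * M) = M"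
  using unitary_matD[OF assms(1)] assms(2)
  by (simp_all add: assoc_mult_mat[of _ n n _ n _ c, symmetric])

lemma unitary_mat_mult:
  assumes "unitary_mat n Q" "unitary_mat n R"
  shows "unitary_mat n (Q * R)"
proof (rule unitary_matI)
  note Q = unitary_matD[OF assms(1)] and R = unitary_matD[OF assms(2)]
  show "Q * R \<in> carrier_mat n n" using Q R by simp
  show "mat_adjoint (Q * R) * (Q * R) = 1\<^sub>m n"
    using Q R unitary_cancel[OF assms(1) R(1)]
    by (simp add: adjoint_mult[of _ n n _ n] assoc_mult_mat[of _ n n _ n _ n])
qed

lemma unitary_mat_uminus:
  assumes "unitary_mat n Q"
  shows "unitary_mat n (- Q)"
  using unitary_matD[OF assms] by (intro unitary_matI) auto

lemma unitary_mat_invertible: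
  assumes "unitary_mat n Q"
  shows "invertible_mat Q"
  using unitary_matD[OF assms] unfolding invertible_mat_def inverts_mat_def by auto

lemma mult_block_diag:
  fixes A B C D :: "complex mat"
  assumes "A \<in> carrier_mat m m" "B \<in> carrier_mat n n" "C \<in> carrier_mat m m" "D \<in> carrier_mat n n"
  shows "four_block_mat A (0\<^sub>m m n) (0\<^sub>m n m) B * four_block_mat C (0\<^sub>m m n) (0\<^sub>m n m) D
    = four_block_mat (A * C) (0\<^sub>m m n) (0\<^sub>m n m) (B * D)"
  using assms by (subst mult_four_block_mat[of _ m m _ n _ n _ _ m _ n]) auto

lemma unitary_block_diag:
  assumes "unitary_mat m P" "unitary_mat n Q"
  shows "unitary_mat (m + n) (four_block_mat P (0\<^sub>m m n) (0\<^sub>m n m) Q)"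
proof (rule unitary_matI)
  note P = unitary_matD[OF assms(1)] and Q = unitary_matD[OF assms(2)]
  show "four_block_mat P (0\<^sub>m m n) (0\<^sub>m n m) Q \<in> carrier_mat (m + n) (m + n)" using P Q by simp
  show "mat_adjoint (four_block_mat P (0\<^sub>m m n) (0\<^sub>m n m) Q) * four_block_mat P (0\<^sub>m m n) (0\<^sub>m n m) Q
    = 1\<^sub>m (m + n)"
    using P Q by (simp add: adjoint_four_block[of _ m m _ n _ n] mult_block_diag)
qed

section \<open>Real diagonal matrices\<close>

definition real_diag :: "nat \<Rightarrow> (nat \<Rightarrow> real) \<Rightarrow> complex mat" where
  "real_diag n d = mat n n (\<lambda>(i, j). if i = j then complex_of_real (d i) else 0)"

lemma real_diag_dim [simp]: "dim_row (real_diag n d) = n" "dim_col (real_diag n d) = n"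
  by (simp_all add: real_diag_def)

lemma real_diag_carrier_iff [simp]: "real_diag n d \<in> carrier_mat r c \<longleftrightarrow> n = r \<and> n = c"
  unfolding carrier_mat_def by simp

lemma real_diag_index [simp]:
  "i < n \<Longrightarrow> j < n \<Longrightarrow> real_diag n d $$ (i, j) = (if i = j then complex_of_real (d i) else 0)"
  by (simp add: real_diag_def)

lemma real_diag_adjoint [simp]: "mat_adjoint (real_diag n d) = real_diag n d"
  by (rule eq_matI) auto

lemma diagonal_mat_real_diag: "diagonal_mat (real_diag n d)"
  by (auto simp: diagonal_mat_def)

lemma index_real_diag_mult:
  assumes "M \<in> carrier_mat n c" "i < n" "j < c"
  shows "(real_diag n d * M) $$ (i, j) = complex_of_real (d i) * M $$ (i, j)"
proof -
  have "(real_diag n d * M) $$ (i, j) = (\<Sum>k\<in>{0..<n}. real_diag n d $$ (i, k) * M $$ (k, j))"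
    using assms by (simp add: scalar_prod_def)
  also have "\<dots> = (\<Sum>k\<in>{0..<n}. if k = i then complex_of_real (d k) * M $$ (k, j) else 0)"
    using assms by (intro sum.cong) auto
  finally show ?thesis using assms by simp
qed

lemma index_mult_real_diag:
  assumes "M \<in> carrier_mat r n" "i < r" "j < n"
  shows "(M * real_diag n d) $$ (i, j) = M $$ (i, j) * complex_of_real (d j)"
proof -
  have "(M * real_diag n d) $$ (i, j) = (\<Sum>k\<in>{0..<n}. M $$ (i, k) * real_diag n d $$ (k, j))"
    using assms by (simp add: scalar_prod_def)
  also have "\<dots> = (\<Sum>k\<in>{0..<n}. if k = j then M $$ (i, k) * complex_of_real (d k) else 0)"
    using assms by (intro sum.cong) auto
  finally show ?thesis using assms by simp
qed

lemma real_diag_mult: "real_diag n d * real_diag n e = real_diag n (\<lambda>i. d i * e i)"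
  by (rule eq_matI) (auto simp: index_real_diag_mult[of _ n n] simp del: index_mult_mat(1))

lemma pos_semidef_real_diag:
  assumes "\<And>i. i < n \<Longrightarrow> d i \<ge> 0"
  shows "pos_semidef_mat n (real_diag n d)"
proof -
  have "0 \<le> (real_diag n d *\<^sub>v v) \<bullet>c v" if v: "v \<in> carrier_vec n" for v
  proof -
    have "(real_diag n d *\<^sub>v v) $ i = complex_of_real (d i) * v $ i" if "i < n" for i
    proof -
      have "(real_diag n d *\<^sub>v v) $ i = (\<Sum>k\<in>{0..<n}. real_diag n d $$ (i, k) * v $ k)"
        using that v by (simp add: scalar_prod_def)
      also have "\<dots> = (\<Sum>k\<in>{0..<n}. if k = i then complex_of_real (d k) * v $ k else 0)"
        using that by (intro sum.cong) auto
      finally show ?thesis using that by simp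
    qed
    then have "(real_diag n d *\<^sub>v v) \<bullet>c v =
      (\<Sum>i\<in>{0..<n}. complex_of_real (d i * (cmod (v $ i))\<^sup>2))"
      using v by (auto simp: scalar_prod_def complex_norm_square mult.assoc
          simp del: index_mult_mat_vec of_real_power intro!: sum.cong)
    also have "\<dots> \<ge> 0" using assms by (intro sum_nonneg) (simp add: less_eq_complex_def)
    finally show ?thesis .
  qed
  then show ?thesis by (simp add: pos_semidef_mat_def)
qed

lemma index_gram_diag:
  assumes "M \<in> carrier_mat r c" "i < c"
  shows "(mat_adjoint M * M :: complex mat) $$ (i, i) = complex_of_real (\<Sum>l<r. (cmod (M $$ (l, i)))\<^sup>2)"
  using assms by (auto simp: scalar_prod_def lessThan_atLeast0 complex_norm_square mult.commute
      simp del: of_real_power intro!: sum.cong)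

lemma gram_eq_real_diag_nonneg:
  assumes "M \<in> carrier_mat r c" "mat_adjoint M * M = real_diag c d" "i < c"
  shows "d i \<ge> 0"
proof -
  have "complex_of_real (d i) = complex_of_real (\<Sum>l<r. (cmod (M $$ (l, i)))\<^sup>2)"
    using index_gram_diag[OF assms(1,3)] assms(2,3) by simp
  then have "d i = (\<Sum>l<r. (cmod (M $$ (l, i)))\<^sup>2)" using of_real_eq_iff by blast
  then show ?thesis by (simp add: sum_nonneg)
qed

section \<open>Matrices with orthogonal columns\<close>

lemma sum_cmod_square_pos:
  assumes "v \<in> carrier_vec n" "v \<noteq> 0\<^sub>v n"
  shows "(\<Sum>l<n. (cmod (v $ l))\<^sup>2) > 0"
proof -
  have "(\<Sum>l<n. (cmod (v $ l))\<^sup>2) \<noteq> 0"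
  proof
    assume "(\<Sum>l<n. (cmod (v $ l))\<^sup>2) = 0"
    then have "\<forall>l<n. v $ l = 0" by (subst (asm) sum_nonneg_eq_0_iff) auto
    then show False using assms by (auto intro!: eq_vecI)
  qed
  then show ?thesis using sum_nonneg[of "{..<n}" "\<lambda>l. (cmod (v $ l))\<^sup>2"] by auto
qed

text \<open>
  A square matrix with orthogonal columns of lengths \<open>|d i|\<close> is a unitary matrix times \<open>diag d\<close>. If all
  lengths are nonzero, one divides each column by \<open>d i\<close>. A zero column makes \<open>M\<close> singular, hence also
  \<open>M\<^sup>*\<close>, and a unit vector in the kernel of \<open>M\<^sup>*\<close> is orthogonal to all columns. Putting it in place of
  the zero column gives a matrix with one zero column less. Its unitary factor also serves for \<open>M\<close>,
  because the weight \<open>d k = 0\<close> erases the new column \<open>k\<close>; so the induction is on the number of zeros of \<open>d\<close>. The lemma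
  takes the place of both the completion of orthonormal systems to bases and the polar decomposition.
\<close>

lemma orthogonal_columns_factor:
  assumes "M \<in> carrier_mat n n"
    and "mat_adjoint M * M = real_diag n (\<lambda>i. (d i)\<^sup>2)"
  shows "\<exists>Q. unitary_mat n Q \<and> M = Q * real_diag n d"
  using assms
proof (induction "card {i. i < n \<and> d i = 0}" arbitrary: M d)
  case 0
  then have nz: "d i \<noteq> 0" if "i < n" for i using that by auto
  define Q where "Q = M * real_diag n (\<lambda>i. 1 / d i)"
  note M = 0(2) and MM = 0(3)
  have one: "real_diag n f = 1\<^sub>m n" if "\<And>i. i < n \<Longrightarrow> f i = 1" for f
    using that by (intro eq_matI) auto
  have "mat_adjoint Q * Q =
    real_diag n (\<lambda>i. 1 / d i) * ((mat_adjoint M * M) * real_diag n (\<lambda>i. 1 / d i))"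
    using M by (simp add: Q_def adjoint_mult[of _ n n _ n] assoc_mult_mat[of _ n n _ n _ n])
  also have "\<dots> = 1\<^sub>m n"
    unfolding MM real_diag_mult using nz by (intro one) (simp add: power2_eq_square)
  finally have "unitary_mat n Q" using M by (intro unitary_matI) (simp_all add: Q_def)
  moreover have "Q * real_diag n d = M"
    using M nz by (simp add: Q_def assoc_mult_mat[of _ n n _ n _ n] real_diag_mult one)
  ultimately show ?case by metis
next
  case (Suc m)
  note M = Suc(3) and MM = Suc(4)
  have "{i. i < n \<and> d i = 0} \<noteq> {}" using Suc(2) by (metis card.empty nat.distinct(1))
  then obtain k where k: "k < n" "d k = 0" by blast
  have gram: "(\<Sum>l<n. cnj (M $$ (l, i)) * M $$ (l, j)) = (if i = j then (d i)\<^sup>2 else 0)"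
    if "i < n" "j < n" for i j
  proof -
    have "(mat_adjoint M * M) $$ (i, j) = (\<Sum>l<n. cnj (M $$ (l, i)) * M $$ (l, j))"
      using that M by (auto simp: scalar_prod_def lessThan_atLeast0 intro!: sum.cong)
    then show ?thesis using that unfolding MM by (cases "i = j") simp_all
  qed
  have Mk: "M $$ (i, k) = 0" if "i < n" for i
  proof -
    have "complex_of_real (\<Sum>l<n. (cmod (M $$ (l, k)))\<^sup>2) = 0"
      using gram[OF k(1) k(1)] k(2) by (simp add: complex_norm_square mult.commute del: of_real_power)
    then have "(\<Sum>l<n. (cmod (M $$ (l, k)))\<^sup>2) = 0" using of_real_eq_0_iff by blast
    then show ?thesis using that by (subst (asm) sum_nonneg_eq_0_iff) auto
  qed
  have "M *\<^sub>v unit_vec n k = 0\<^sub>v n"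
    using M k Mk by (intro eq_vecI) auto
  then have "det M = 0"
    using det_0_iff_vec_prod_zero_field[OF M] k by (metis unit_vec_carrier unit_vec_nonzero)
  then have "det (mat_adjoint M) = 0" by (rule det_adjoint_eq_0[OF M])
  then obtain u where u: "u \<in> carrier_vec n" "u \<noteq> 0\<^sub>v n" "mat_adjoint M *\<^sub>v u = 0\<^sub>v n"
    using det_0_iff_vec_prod_zero_field[of "mat_adjoint M" n] M by auto
  define t where "t = (\<Sum>l<n. (cmod (u $ l))\<^sup>2)"
  have t: "t > 0" unfolding t_def by (rule sum_cmod_square_pos[OF u(1,2)])
  define v where "v l = u $ l / complex_of_real (sqrt t)" for l
  have v1: "(\<Sum>l<n. cnj (v l) * v l) = 1"
  proof -
    have "(\<Sum>l<n. cnj (v l) * v l) = complex_of_real (\<Sum>l<n. (cmod (u $ l))\<^sup>2 / t)"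
      unfolding of_real_sum using t
      by (intro sum.cong)
        (auto simp: v_def complex_norm_square mult.commute simp flip: of_real_mult simp del: of_real_power)
    then show ?thesis using t by (simp add: t_def flip: sum_divide_distrib)
  qed
  have Mv: "(\<Sum>l<n. cnj (M $$ (l, j)) * v l) = 0" if "j < n" for j
  proof -
    have "(mat_adjoint M *\<^sub>v u) $ j = (\<Sum>l<n. cnj (M $$ (l, j)) * u $ l)"
      using that M u(1) by (auto simp: scalar_prod_def lessThan_atLeast0 intro!: sum.cong)
    then have "(\<Sum>l<n. cnj (M $$ (l, j)) * u $ l) = 0" 
      using arg_cong[OF u(3), of "\<lambda>x. x $ j"] that by (simp del: index_mult_mat_vec)
    then show ?thesis by (simp add: v_def flip: sum_divide_distrib)
  qed
  have vM: "(\<Sum>l<n. cnj (v l) * M $$ (l, j)) = 0" if "j < n" for j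
    using arg_cong[OF Mv[OF that], of cnj] by (simp add: mult.commute)
  \<comment> \<open>Column \<open>k\<close> of \<open>M'\<close> is the unit vector; its weight changes from 0 to 1.\<close>
  define M' where "M' = mat n n (\<lambda>(i, j). if j = k then v i else M $$ (i, j))"
  define d' where "d' = d(k := 1)"
  have M': "M' \<in> carrier_mat n n" by (simp add: M'_def)
  have "mat_adjoint M' * M' = real_diag n (\<lambda>i. (d' i)\<^sup>2)"
  proof (rule eq_matI)
    fix i j assume "i < dim_row (real_diag n (\<lambda>i. (d' i)\<^sup>2))" "j < dim_col (real_diag n (\<lambda>i. (d' i)\<^sup>2))"
    then have ij: "i < n" "j < n" by auto
    have "(mat_adjoint M' * M') $$ (i, j) = (\<Sum>l<n. cnj (M' $$ (l, i)) * M' $$ (l, j))"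
      using ij M' by (auto simp: scalar_prod_def lessThan_atLeast0 intro!: sum.cong)
    also have "\<dots> = (if i = j then (d' i)\<^sup>2 else 0)"
      using ij k gram v1 Mv vM by (cases "i = k"; cases "j = k") (auto simp: M'_def d'_def)
    finally show "(mat_adjoint M' * M') $$ (i, j) = real_diag n (\<lambda>i. (d' i)\<^sup>2) $$ (i, j)"
      using ij by simp
  qed (use M' in auto)
  moreover have "m = card {i. i < n \<and> d' i = 0}"
  proof -
    have "{i. i < n \<and> d' i = 0} = {i. i < n \<and> d i = 0} - {k}" by (auto simp: d'_def)
    then show ?thesis using Suc(2) k by simp
  qed
  ultimately obtain Q where Q: "unitary_mat n Q" "M' = Q * real_diag n d'"
    using Suc(1) M' by blast
  note Qc = unitary_matD(1)[OF Q(1)]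
  have "M = Q * real_diag n d"
  proof (rule eq_matI)
    fix i j assume "i < dim_row (Q * real_diag n d)" "j < dim_col (Q * real_diag n d)"
    then have ij: "i < n" "j < n" using Qc by auto
    have "M' $$ (i, j) = Q $$ (i, j) * complex_of_real (d' j)"
      unfolding Q(2) using ij Qc by (rule_tac index_mult_real_diag)
    then show "M $$ (i, j) = (Q * real_diag n d) $$ (i, j)"
      using ij k Mk by (auto simp: index_mult_real_diag[OF Qc] M'_def d'_def simp del: index_mult_mat(1) split: if_splits)
  qed (use M Qc in auto)
  then show ?case using Q(1) by blast
qed

section \<open>The spectral theorem for Hermitian matrices\<close>

text \<open>
  The spectral theorem, by induction on the size: an eigenvector is completed to a unitary matrix \<open>Q\<close> whose
  first column is a multiple of it, and since \<open>Q\<^sup>* H Q\<close> is again Hermitian, not only its first column but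
  also its first row vanishes outside the corner. What remains is a Hermitian matrix of size one less.
\<close>

theorem hermitian_unitary_diagonalization:
  assumes "H \<in> carrier_mat n n" "mat_adjoint H = H"
  shows "\<exists>V d. unitary_mat n V \<and> mat_adjoint V * H * V = real_diag n d"
  using assms
proof (induction n arbitrary: H)
  case 0
  have "unitary_mat 0 (1\<^sub>m 0)" by (rule unitary_matI) simp_all
  moreover have "mat_adjoint (1\<^sub>m 0) * H * 1\<^sub>m 0 = real_diag 0 (\<lambda>_. 0)"
    using 0 by (intro eq_matI) auto
  ultimately show ?case by blast
next
  case (Suc n)
  let ?N = "Suc n"
  note H = Suc.prems(1) and herm = Suc.prems(2)
  obtain \<mu> v where "eigenvector H v \<mu>"
    using spectrum_non_empty[OF H] unfolding spectrum_def eigenvalue_def by auto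
  then have v: "v \<in> carrier_vec ?N" "v \<noteq> 0\<^sub>v ?N" "H *\<^sub>v v = \<mu> \<cdot>\<^sub>v v"
    using H by (auto simp: eigenvector_def)
  define t where "t = (\<Sum>l<?N. (cmod (v $ l))\<^sup>2)"
  have t: "t > 0" unfolding t_def by (rule sum_cmod_square_pos[OF v(1,2)])
  \<comment> \<open>The matrix with columns \<open>v, 0, \<dots>, 0\<close> has orthogonal columns, so it factors as \<open>Q diag d\<close>.
    The first column of \<open>Q\<close> is then \<open>v\<close> divided by its length.\<close>
  define M where "M = mat ?N ?N (\<lambda>(i, j). if j = 0 then v $ i else 0)"
  define d where "d i = (if i = 0 then sqrt t else 0)" for i :: nat
  have M: "M \<in> carrier_mat ?N ?N" by (simp add: M_def)
  have "mat_adjoint M * M = real_diag ?N (\<lambda>i. (d i)\<^sup>2)"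
  proof (rule eq_matI)
    fix i j assume "i < dim_row (real_diag ?N (\<lambda>i. (d i)\<^sup>2))" "j < dim_col (real_diag ?N (\<lambda>i. (d i)\<^sup>2))"
    then have ij: "i < ?N" "j < ?N" by auto
    show "(mat_adjoint M * M) $$ (i, j) = real_diag ?N (\<lambda>i. (d i)\<^sup>2) $$ (i, j)"
    proof (cases "i = 0 \<and> j = 0")
      case True
      then have "(mat_adjoint M * M) $$ (i, j) = complex_of_real (\<Sum>l<?N. (cmod (M $$ (l, 0)))\<^sup>2)"
        using index_gram_diag[OF M, of 0] by simp
      also have "\<dots> = complex_of_real t"
        unfolding t_def of_real_eq_iff by (rule sum.cong) (auto simp: M_def)
      finally show ?thesis using True t by (simp add: d_def flip: of_real_power)
    next
      case False
      then have "(mat_adjoint M * M) $$ (i, j) = 0"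
        using ij M by (auto simp: scalar_prod_def M_def)
      then show ?thesis using False ij by (auto simp: d_def)
    qed
  qed (use M in auto)
  then obtain Q where Q: "unitary_mat ?N Q" "M = Q * real_diag ?N d"
    using orthogonal_columns_factor[OF M] by blast
  note Qc = unitary_matD[OF Q(1)]
  have HM: "H * M = \<mu> \<cdot>\<^sub>m M"
  proof (rule eq_matI)
    fix i j assume "i < dim_row (\<mu> \<cdot>\<^sub>m M)" "j < dim_col (\<mu> \<cdot>\<^sub>m M)"
    then have ij: "i < ?N" "j < ?N" using M by auto
    have "col M j = (if j = 0 then v else 0\<^sub>v ?N)"
      using ij v(1) by (auto simp: M_def intro!: eq_vecI)
    moreover have "(H *\<^sub>v v) $ i = \<mu> * v $ i" using v ij by simp
    ultimately show "(H * M) $$ (i, j) = (\<mu> \<cdot>\<^sub>m M) $$ (i, j)"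
      using ij H M by (auto simp: M_def)
  qed (use H M in auto)
  define K where "K = mat_adjoint Q * (H * Q)"
  have K: "K \<in> carrier_mat ?N ?N" using Qc H by (simp add: K_def)
  have Kherm: "mat_adjoint K = K"
    using Qc H herm
    by (simp add: K_def adjoint_mult[of _ ?N ?N _ ?N] assoc_mult_mat[of _ ?N ?N _ ?N _ ?N])
  have "K * real_diag ?N d = mat_adjoint Q * (H * M)"
    using Qc H unfolding K_def Q(2) by (simp add: assoc_mult_mat[of _ ?N ?N _ ?N _ ?N])
  also have "\<dots> = \<mu> \<cdot>\<^sub>m (mat_adjoint Q * M)" unfolding HM
    by (rule mult_smult_distrib[of _ ?N ?N _ ?N]) (use Qc M in auto)
  also have "mat_adjoint Q * M = real_diag ?N d"
    unfolding Q(2) using unitary_cancel(1)[OF Q(1)] by simp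
  finally have Kd: "K * real_diag ?N d = \<mu> \<cdot>\<^sub>m real_diag ?N d" .
  have Kcol: "K $$ (i, 0) = 0" if "i < ?N" "i \<noteq> 0" for i
  proof -
    have "K $$ (i, 0) * complex_of_real (d 0) = (K * real_diag ?N d) $$ (i, 0)"
      using that by (subst index_mult_real_diag[OF K]) auto
    also have "\<dots> = 0" unfolding Kd using that by simp
    finally show ?thesis using t by (simp add: d_def)
  qed
  have Krow: "K $$ (0, i) = 0" if "i < ?N" "i \<noteq> 0" for i
    using Kcol[OF that] arg_cong[OF Kherm, of "\<lambda>A. A $$ (0, i)"] that K by auto
  have K00: "K $$ (0, 0) = complex_of_real (Re (K $$ (0, 0)))"
    using arg_cong[OF Kherm, of "\<lambda>A. A $$ (0, 0)"] K
    by (simp add: complex_eq_iff)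
  define L where "L = mat n n (\<lambda>(i, j). K $$ (Suc i, Suc j))"
  have L: "L \<in> carrier_mat n n" by (simp add: L_def)
  have "mat_adjoint L = L"
  proof (rule eq_matI)
    fix i j assume "i < dim_row L" "j < dim_col L"
    then have ij: "i < n" "j < n" by (auto simp: L_def)
    have "mat_adjoint K $$ (Suc i, Suc j) = conjugate (K $$ (Suc j, Suc i))" using ij K by simp
    then show "mat_adjoint L $$ (i, j) = L $$ (i, j)"
      using ij Kherm by (simp add: L_def)
  qed (simp_all add: L_def)
  then obtain V e where V: "unitary_mat n V" "mat_adjoint V * L * V = real_diag n e"
    using Suc.IH[OF L] by blast
  note Vc = unitary_matD[OF V(1)]
  define k where "k = mat 1 1 (\<lambda>_. K $$ (0, 0))"
  have k: "k \<in> carrier_mat 1 1" by (simp add: k_def)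
  have Kblock: "K = four_block_mat k (0\<^sub>m 1 n) (0\<^sub>m n 1) L"
    using K by (intro eq_matI) (auto simp: k_def L_def Kcol Krow)
  define W where "W = four_block_mat (1\<^sub>m 1) (0\<^sub>m 1 n) (0\<^sub>m n 1) V"
  have "unitary_mat (1 + n) W"
    unfolding W_def by (rule unitary_block_diag[OF unitary_matI V(1)]) simp_all
  then have W: "unitary_mat ?N W" by simp
  note Wc = unitary_matD[OF W]
  have "mat_adjoint W * K * W = four_block_mat k (0\<^sub>m 1 n) (0\<^sub>m n 1) (mat_adjoint V * L * V)"
    unfolding Kblock W_def using Vc k L
    by (simp add: adjoint_four_block[of _ 1 1 _ n _ n] mult_block_diag[of _ 1 _ n]
        assoc_mult_mat[of _ n n _ n _ n] del: One_nat_def)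
  also have "\<dots> = real_diag ?N (case_nat (Re (K $$ (0, 0))) e)"
    unfolding V(2) using K00 by (intro eq_matI) (auto simp: k_def split: nat.splits)
  finally have "mat_adjoint W * K * W = real_diag ?N (case_nat (Re (K $$ (0, 0))) e)" .
  moreover have "mat_adjoint (Q * W) * H * (Q * W) = mat_adjoint W * K * W"
    using Qc Wc H
    by (simp add: K_def adjoint_mult[of _ ?N ?N _ ?N] assoc_mult_mat[of _ ?N ?N _ ?N _ ?N])
  ultimately show ?case using unitary_mat_mult[OF Q(1) W] by metis
qed

section \<open>The CS decomposition\<close>

lemma four_block_mat_inject:
  assumes eq: "four_block_mat A B C D = four_block_mat A' B' C' D'"
    and c: "A \<in> carrier_mat r1 c1" "B \<in> carrier_mat r1 c2" "C \<in> carrier_mat r2 c1" "D \<in> carrier_mat r2 c2"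
    "A' \<in> carrier_mat r1 c1" "B' \<in> carrier_mat r1 c2" "C' \<in> carrier_mat r2 c1" "D' \<in> carrier_mat r2 c2"
  shows "A = A'" "B = B'" "C = C'" "D = D'"
proof -
  note ix = arg_cong[OF eq, of "\<lambda>M. M $$ (i, j)" for i j]
  show "A = A'"
  proof (rule eq_matI)
    fix i j assume "i < dim_row A'" "j < dim_col A'"
    then show "A $$ (i, j) = A' $$ (i, j)" using ix[of i j] c by simp
  qed (use c in auto)
  show "B = B'"
  proof (rule eq_matI)
    fix i j assume "i < dim_row B'" "j < dim_col B'"
    then show "B $$ (i, j) = B' $$ (i, j)" using ix[of i "c1 + j"] c by simp
  qed (use c in auto)
  show "C = C'"
  proof (rule eq_matI)
    fix i j assume "i < dim_row C'" "j < dim_col C'"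
    then show "C $$ (i, j) = C' $$ (i, j)" using ix[of "r1 + i" j] c by simp
  qed (use c in auto)
  show "D = D'"
  proof (rule eq_matI)
    fix i j assume "i < dim_row D'" "j < dim_col D'"
    then show "D $$ (i, j) = D' $$ (i, j)" using ix[of "r1 + i" "c1 + j"] c by simp
  qed (use c in auto)
qed

text \<open>
  The diagonal blocks of \<open>Y\<^sup>* Y = I\<close> and \<open>Y Y\<^sup>* = I\<close> have the form \<open>G + G' = I\<close>. A unitary change of
  basis that diagonalizes \<open>G\<close> therefore diagonalizes \<open>G'\<close>, with the complementary eigenvalues.
\<close>

lemma unitary_conj_one_minus:
  assumes "unitary_mat n V" "G + G' = 1\<^sub>m n" "G \<in> carrier_mat n n" "G' \<in> carrier_mat n n"
    and "mat_adjoint V * G * V = real_diag n d"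
  shows "mat_adjoint V * G' * V = real_diag n (\<lambda>i. 1 - d i)"
proof -
  note V = unitary_matD[OF assms(1)]
  have "mat_adjoint V * G * V + mat_adjoint V * G' * V = mat_adjoint V * (G + G') * V"
    using V assms(3,4)
    by (simp add: mult_add_distrib_mat[of _ n n _ n] add_mult_distrib_mat[of _ n n _ _ n])
  also have "\<dots> = 1\<^sub>m n" using V assms(2) by simp
  finally have *: "real_diag n d + mat_adjoint V * G' * V = 1\<^sub>m n" using assms(5) by simp
  show ?thesis
  proof (rule eq_matI)
    fix i j assume "i < dim_row (real_diag n (\<lambda>i. 1 - d i))" "j < dim_col (real_diag n (\<lambda>i. 1 - d i))"
    then have ij: "i < n" "j < n" by auto
    have "(real_diag n d + mat_adjoint V * G' * V) $$ (i, j) =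
      real_diag n d $$ (i, j) + (mat_adjoint V * G' * V) $$ (i, j)"
      by (rule index_add_mat(1)) (use ij V in auto)
    then show "(mat_adjoint V * G' * V) $$ (i, j) = real_diag n (\<lambda>i. 1 - d i) $$ (i, j)"
      unfolding * using ij by (auto simp: algebra_simps simp del: index_mult_mat(1))
  qed (use V in auto)
qed

text \<open>
  The CS decomposition of a unitary matrix in four square blocks of equal size.

  Diagonalizing \<open>Y11\<^sup>* Y11\<close> makes the columns of \<open>Y11\<close>, and because of \<open>Y11\<^sup>* Y11 + Y21\<^sup>* Y21 = I\<close> also those of
  \<open>Y21\<close>, orthogonal in one common basis \<open>V\<close>. The column lengths \<open>c i\<close> and \<open>s i\<close> satisfy
  \<open>(c i)\<^sup>2 + (s i)\<^sup>2 = 1\<close>, and factoring out unitary matrices gives \<open>U1\<close> and \<open>U2\<close>. In the same way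
  \<open>Y11 Y11\<^sup>* + Y12 Y12\<^sup>* = I\<close> gives \<open>Y12 = U1 S R\<^sup>*\<close> with a unitary \<open>R\<close>.

  The choice of \<open>R\<close> is arbitrary on the kernel of \<open>S\<close>, so \<open>X = U2\<^sup>* Y22 R\<close> need not be \<open>C\<close>. Orthogonality of the
  two block columns says \<open>S X = C S\<close>: the rows of \<open>X\<close> with \<open>s i \<noteq> 0\<close> are those of \<open>C\<close>, while
  \<open>c i = 1\<close> in the others. Hence \<open>F = X + (I - C)\<close> has the rows of \<open>I\<close> where \<open>s i \<noteq> 0\<close> and those
  of \<open>X\<close> elsewhere. It satisfies \<open>S F = S\<close> and \<open>C F = X\<close> and is unitary, so that replacing
  \<open>R\<^sup>*\<close> by \<open>F R\<^sup>*\<close> leaves \<open>Y12\<close> as it is and brings \<open>Y22\<close> into the required form.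
\<close>

theorem cs_decomposition:
  assumes Y11: "Y11 \<in> carrier_mat n n" and Y12: "Y12 \<in> carrier_mat n n"
    and Y21: "Y21 \<in> carrier_mat n n" and Y22: "Y22 \<in> carrier_mat n n"
    and Y: "unitary_mat (n + n) (four_block_mat Y11 Y12 Y21 Y22)"
  obtains U1 U2 V1 V2 c s where
    "unitary_mat n U1" "unitary_mat n U2" "unitary_mat n V1" "unitary_mat n V2"
    "\<And>i. i < n \<Longrightarrow> c i \<ge> 0" "\<And>i. i < n \<Longrightarrow> s i \<ge> 0" "\<And>i. i < n \<Longrightarrow> (c i)\<^sup>2 + (s i)\<^sup>2 = 1"
    "Y11 = U1 * real_diag n c * V1" "Y12 = U1 * real_diag n s * V2"
    "Y21 = - (U2 * real_diag n s * V1)" "Y22 = U2 * real_diag n c * V2"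
proof -
  note Yc = Y11 Y12 Y21 Y22
  note am = adjoint_mult[of _ n n _ n]
  note as = assoc_mult_mat[of _ n n _ n _ n]
  let ?Y = "four_block_mat Y11 Y12 Y21 Y22"
  have aY: "mat_adjoint ?Y = four_block_mat (mat_adjoint Y11) (mat_adjoint Y21) (mat_adjoint Y12) (mat_adjoint Y22)"
    by (rule adjoint_four_block) (rule Y11 Y12 Y21 Y22)+
  note blocks = four_block_mat_inject[of _ _ _ _ _ _ _ _ n n n n]
  have "four_block_mat (mat_adjoint Y11 * Y11 + mat_adjoint Y21 * Y21) (mat_adjoint Y11 * Y12 + mat_adjoint Y21 * Y22)
      (mat_adjoint Y12 * Y11 + mat_adjoint Y22 * Y21) (mat_adjoint Y12 * Y12 + mat_adjoint Y22 * Y22)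
    = mat_adjoint ?Y * ?Y"
    unfolding aY by (rule mult_four_block_mat[symmetric, of _ n n _ n _ n _ _ n _ n]) (use Yc in auto)
  also have "\<dots> = four_block_mat (1\<^sub>m n) (0\<^sub>m n n) (0\<^sub>m n n) (1\<^sub>m n)"
    using unitary_matD(3)[OF Y] by simp
  finally have c1: "mat_adjoint Y11 * Y11 + mat_adjoint Y21 * Y21 = 1\<^sub>m n"
    and c12: "mat_adjoint Y11 * Y12 + mat_adjoint Y21 * Y22 = 0\<^sub>m n n"
    and c2: "mat_adjoint Y12 * Y12 + mat_adjoint Y22 * Y22 = 1\<^sub>m n"
    by (rule blocks; use Yc in auto)+
  have "four_block_mat (Y11 * mat_adjoint Y11 + Y12 * mat_adjoint Y12) (Y11 * mat_adjoint Y21 + Y12 * mat_adjoint Y22)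
      (Y21 * mat_adjoint Y11 + Y22 * mat_adjoint Y12) (Y21 * mat_adjoint Y21 + Y22 * mat_adjoint Y22)
    = ?Y * mat_adjoint ?Y"
    unfolding aY by (rule mult_four_block_mat[symmetric, of _ n n _ n _ n _ _ n _ n]) (use Yc in auto)
  also have "\<dots> = four_block_mat (1\<^sub>m n) (0\<^sub>m n n) (0\<^sub>m n n) (1\<^sub>m n)"
    using unitary_matD(4)[OF Y] by simp
  finally have r1: "Y11 * mat_adjoint Y11 + Y12 * mat_adjoint Y12 = 1\<^sub>m n"
    by (rule blocks) (use Yc in auto)
  obtain V e where V: "unitary_mat n V"
    and Ve: "mat_adjoint V * (mat_adjoint Y11 * Y11) * V = real_diag n e"
    using hermitian_unitary_diagonalization[of "mat_adjoint Y11 * Y11" n] Yc by (auto simp: am)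
  note Vc = unitary_matD[OF V] Yc
  have Ve': "mat_adjoint V * (mat_adjoint Y21 * Y21) * V = real_diag n (\<lambda>i. 1 - e i)"
    by (rule unitary_conj_one_minus[OF V c1 _ _ Ve]) (use Yc in auto)
  define a where "a = Y11 * V"
  define b where "b = Y21 * V"
  have a: "a \<in> carrier_mat n n" and b: "b \<in> carrier_mat n n" using Vc by (simp_all add: a_def b_def)
  have aa: "mat_adjoint a * a = real_diag n e" and bb: "mat_adjoint b * b = real_diag n (\<lambda>i. 1 - e i)"
    using Ve Ve' Vc by (simp_all add: a_def b_def am as)
  have e0: "0 \<le> e i" and e1: "0 \<le> 1 - e i" if "i < n" for i
    using gram_eq_real_diag_nonneg[OF a aa that] gram_eq_real_diag_nonneg[OF b bb that] by auto
  define c where "c i = sqrt (e i)" for i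
  define s where "s i = sqrt (1 - e i)" for i
  let ?C = "real_diag n c" and ?S = "real_diag n s"
  have c0: "c i \<ge> 0" and s0: "s i \<ge> 0" and cs: "(c i)\<^sup>2 + (s i)\<^sup>2 = 1" if "i < n" for i
    using e0[OF that] e1[OF that] by (simp_all add: c_def s_def)
  have rd: "real_diag n f = real_diag n g" if "\<And>i. i < n \<Longrightarrow> f i = g i" for f g
    using that by (intro eq_matI) auto
  have ec: "real_diag n e = real_diag n (\<lambda>i. (c i)\<^sup>2)"
    and es: "real_diag n (\<lambda>i. 1 - e i) = real_diag n (\<lambda>i. (s i)\<^sup>2)"
    using e0 e1 by (auto intro!: rd simp: c_def s_def)
  obtain U1 where U1: "unitary_mat n U1" "a = U1 * ?C"
    using orthogonal_columns_factor[OF a aa[unfolded ec]] by blast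
  obtain Z where Z: "unitary_mat n Z" "b = Z * ?S"
    using orthogonal_columns_factor[OF b bb[unfolded es]] by blast
  define U2 where "U2 = - Z"
  have U2: "unitary_mat n U2" unfolding U2_def by (rule unitary_mat_uminus[OF Z(1)])
  note U1c = unitary_matD[OF U1(1)] Yc and Zc = unitary_matD[OF Z(1)] and U2c = unitary_matD[OF U2] Yc
  have bU2: "b = - (U2 * ?S)" unfolding Z(2) U2_def using Zc(1) by simp
  have Y11_eq: "Y11 = U1 * ?C * mat_adjoint V"
    unfolding U1(2)[symmetric] a_def using Vc by (simp add: as)
  have Y21_eq: "Y21 = - (U2 * ?S * mat_adjoint V)"
  proof -
    have "Y21 = b * mat_adjoint V" unfolding b_def using Vc by (simp add: as)
    then show ?thesis unfolding bU2 using Vc U2c by simp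
  qed
  have "mat_adjoint U1 * (Y11 * mat_adjoint Y11) * U1 = ?C * ?C"
    unfolding Y11_eq using Vc U1c
    by (simp add: am as unitary_cancel[OF V, of _ n] unitary_cancel[OF U1(1), of _ n])
  then have "mat_adjoint U1 * (Y12 * mat_adjoint Y12) * U1 = real_diag n (\<lambda>i. 1 - c i * c i)"
    unfolding real_diag_mult by (rule unitary_conj_one_minus[OF U1(1) r1, rotated 2]) (use Yc in auto)
  also have "\<dots> = real_diag n (\<lambda>i. (s i)\<^sup>2)"
    using cs by (intro rd) (simp add: power2_eq_square algebra_simps)
  finally have "mat_adjoint (mat_adjoint Y12 * U1) * (mat_adjoint Y12 * U1) = real_diag n (\<lambda>i. (s i)\<^sup>2)"
    using U1c by (simp add: am as)
  then obtain R where R: "unitary_mat n R" "mat_adjoint Y12 * U1 = R * ?S"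
    using orthogonal_columns_factor[of "mat_adjoint Y12 * U1" n s] U1c by auto
  note Rc = unitary_matD[OF R(1)] Yc
  have Y12_eq: "Y12 = U1 * ?S * mat_adjoint R"
  proof -
    have "mat_adjoint U1 * Y12 = ?S * mat_adjoint R"
      using arg_cong[OF R(2), of mat_adjoint] U1c Rc by (simp add: am)
    then have "U1 * (mat_adjoint U1 * Y12) = U1 * (?S * mat_adjoint R)" by simp
    then show ?thesis using U1c Rc by (simp add: as unitary_cancel[OF U1(1), of _ n])
  qed
  define X where "X = mat_adjoint U2 * (Y22 * R)"
  have X: "X \<in> carrier_mat n n" using U2c Rc by (simp add: X_def)
  have SX: "?S * X = ?C * ?S"
  proof -
    have "mat_adjoint V * (mat_adjoint Y11 * Y12) * R = ?C * ?S"
      unfolding Y11_eq Y12_eq using Vc U1c Rc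
      by (simp add: am as unitary_cancel[OF V, of _ n] unitary_cancel[OF U1(1), of _ n])
    moreover have "mat_adjoint V * (mat_adjoint Y21 * Y22) * R = - (?S * X)"
      unfolding Y21_eq X_def using Vc U2c Rc
      by (simp add: am as unitary_cancel[OF V, of _ n])
    moreover have "mat_adjoint V * (mat_adjoint Y11 * Y12) * R + mat_adjoint V * (mat_adjoint Y21 * Y22) * R
      = mat_adjoint V * (mat_adjoint Y11 * Y12 + mat_adjoint Y21 * Y22) * R"
      using Vc Rc
      by (simp add: mult_add_distrib_mat[of _ n n _ n] add_mult_distrib_mat[of _ n n _ _ n])
    ultimately have *: "?C * ?S + - (?S * X) = 0\<^sub>m n n" unfolding c12 using Vc Rc by simp
    show ?thesis
    proof (rule eq_matI)
      fix i j assume "i < dim_row (?C * ?S)" "j < dim_col (?C * ?S)"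
      then have ij: "i < n" "j < n" by auto
      have "(?C * ?S + - (?S * X)) $$ (i, j) = (?C * ?S) $$ (i, j) - (?S * X) $$ (i, j)"
        using ij X by (simp del: index_mult_mat(1))
      then show "(?S * X) $$ (i, j) = (?C * ?S) $$ (i, j)" unfolding * using ij by simp
    qed (use X in auto)
  qed
  have XX: "mat_adjoint X * X = real_diag n (\<lambda>i. (c i)\<^sup>2)"
  proof -
    have "mat_adjoint R * (mat_adjoint Y12 * Y12) * R = ?S * ?S"
      unfolding Y12_eq using U1c Rc
      by (simp add: am as unitary_cancel[OF R(1), of _ n] unitary_cancel[OF U1(1), of _ n])
    then have "mat_adjoint R * (mat_adjoint Y22 * Y22) * R = real_diag n (\<lambda>i. 1 - s i * s i)"
      unfolding real_diag_mult by (rule unitary_conj_one_minus[OF R(1) c2, rotated 2]) (use Yc in auto)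
    also have "\<dots> = real_diag n (\<lambda>i. (c i)\<^sup>2)"
      using cs by (intro rd) (simp add: power2_eq_square algebra_simps)
    finally show ?thesis
      using U2c Rc by (simp add: X_def am as unitary_cancel[OF U2, of _ n])
  qed
  have SXi: "complex_of_real (s i) * X $$ (i, j) = (if i = j then complex_of_real (s i * c i) else 0)"
    if "i < n" "j < n" for i j
    using arg_cong[OF SX, of "\<lambda>M. M $$ (i, j)"] that X
    by (simp add: index_real_diag_mult[of _ n n] real_diag_mult mult.commute del: index_mult_mat(1))
  \<comment> \<open>\<open>1 - c i\<close> vanishes whenever \<open>s i\<close> does, so the relation passes from \<open>S\<close> to \<open>I - C\<close>.\<close>
  have TXi: "complex_of_real (1 - c i) * X $$ (i, j) = (if i = j then complex_of_real ((1 - c i) * c i) else 0)"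
    if "i < n" "j < n" for i j
  proof (cases "s i = 0")
    case True
    then have "c i = 1" using cs[OF that(1)] c0[OF that(1)] by (simp add: power2_eq_1_iff)
    then show ?thesis by auto
  next
    case False
    then have "X $$ (i, j) = (if i = j then complex_of_real (c i) else 0)"
      using SXi[OF that] by (auto split: if_splits)
    then show ?thesis by simp
  qed
  \<comment> \<open>The correction on the kernel of \<open>S\<close>.\<close>
  define T where "T = real_diag n (\<lambda>i. 1 - c i)"
  define F where "F = X + T"
  have T: "T \<in> carrier_mat n n" and F: "F \<in> carrier_mat n n" using X by (simp_all add: T_def F_def)
  have TX: "T * X = real_diag n (\<lambda>i. (1 - c i) * c i)"
    using TXi X by (intro eq_matI)
      (auto simp: T_def index_real_diag_mult[of _ n n] simp del: index_mult_mat(1))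
  have "mat_adjoint X * T = mat_adjoint (T * X)" using X T by (simp add: am T_def)
  then have XT: "mat_adjoint X * T = real_diag n (\<lambda>i. (1 - c i) * c i)" unfolding TX by simp
  have TT: "T * T = real_diag n (\<lambda>i. (1 - c i) * (1 - c i))" by (simp add: T_def real_diag_mult)
  have "mat_adjoint F * F = (mat_adjoint X * X + T * X) + (mat_adjoint X * T + T * T)"
    unfolding F_def using X T
    by (simp add: adjoint_add[of _ n n] mult_add_distrib_mat[of _ n n _ n] add_mult_distrib_mat[of _ n n _ _ n])
      (simp add: T_def)
  also have "\<dots> = 1\<^sub>m n"
    unfolding XX TX XT TT by (intro eq_matI) (auto simp: power2_eq_square algebra_simps)
  finally have Fu: "unitary_mat n F" by (rule unitary_matI[OF F])
  have CF: "?C * F = X"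
  proof (rule eq_matI)
    fix i j assume "i < dim_row X" "j < dim_col X"
    then have ij: "i < n" "j < n" using X by auto
    have "(?C * F) $$ (i, j) = complex_of_real (c i) * (X $$ (i, j) + T $$ (i, j))"
      unfolding index_real_diag_mult[OF F ij] using ij X T by (simp add: F_def)
    then show "(?C * F) $$ (i, j) = X $$ (i, j)"
      using TXi[OF ij] ij by (auto simp: T_def algebra_simps split: if_splits)
  qed (use X F in auto)
  have SF: "?S * F = ?S"
  proof (rule eq_matI)
    fix i j assume "i < dim_row ?S" "j < dim_col ?S"
    then have ij: "i < n" "j < n" by auto
    have "(?S * F) $$ (i, j) = complex_of_real (s i) * (X $$ (i, j) + T $$ (i, j))"
      unfolding index_real_diag_mult[OF F ij] using ij X T by (simp add: F_def)
    then show "(?S * F) $$ (i, j) = ?S $$ (i, j)"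
      using SXi[OF ij] ij by (auto simp: T_def algebra_simps split: if_splits)
  qed (use F in auto)
  have "unitary_mat n (F * mat_adjoint R)"
    using unitary_mat_mult[OF Fu unitary_mat_adjoint[OF R(1)]] .
  moreover have "Y12 = U1 * ?S * (F * mat_adjoint R)"
  proof -
    have "U1 * ?S * (F * mat_adjoint R) = U1 * ((?S * F) * mat_adjoint R)"
      using U1c F Rc by (simp add: as)
    then show ?thesis unfolding SF Y12_eq using U1c Rc by (simp add: as)
  qed
  moreover have "Y22 = U2 * ?C * (F * mat_adjoint R)"
  proof -
    have "U2 * ?C * (F * mat_adjoint R) = U2 * ((?C * F) * mat_adjoint R)"
      using U2c F Rc by (simp add: as)
    then show ?thesis unfolding CF X_def using U2c Rc by (simp add: as unitary_cancel[OF U2, of _ n])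
  qed
  ultimately show thesis
    using that[OF U1(1) U2 unitary_mat_adjoint[OF V] _ c0 s0 cs Y11_eq _ Y21_eq] by blast
qed

section \<open>Rank\<close>

text \<open>
  The rank-nullity theorem for the linear map \<open>v \<mapsto> A v\<close>. It gives access to the rank through the
  dimension of the kernel, which is easy to follow through products with invertible matrices and block
  diagonal matrices.
\<close>

lemma (in vec_space) rank_plus_kernel_dim:
  assumes A: "A \<in> carrier_mat n nc"
  shows "rank A + kernel.dim nc A = nc"
proof -
  interpret NC: vec_space "TYPE('a)" nc .
  interpret lm: linear_map class_ring NC.V V "\<lambda>v. A *\<^sub>v v"
  proof (intro linear_map.intro mod_hom.intro)
    show "mod_hom_axioms class_ring NC.V V (\<lambda>v. A *\<^sub>v v)"
      using A mult_add_distrib_mat_vec[OF A] mult_mat_vec[OF A]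
      by unfold_locales (auto simp: LinearCombinations.module_hom_def)
  qed unfold_locales
  have ker: "lm.ker = mat_kernel A"
    using A by (auto simp: lm.ker_def mat_kernel)
  have im: "lm.im = span (set (cols A))"
    using col_space_eq[OF A] A unfolding col_space_def lm.im_def by auto
  have "vectorspace.dim class_ring (vs lm.im) + vectorspace.dim class_ring (NC.vs lm.ker) = NC.dim"
    by (rule lm.rank_nullity[OF NC.fin_dim])
  then show ?thesis unfolding ker im rank_def NC.dim_is_n by simp
qed

lemma rank_mult_invertible:
  fixes A :: "complex mat"
  assumes "A \<in> carrier_mat n n" "G \<in> carrier_mat n n" "H \<in> carrier_mat n n"
    and "invertible_mat G" "invertible_mat H"
  shows "vec_space.rank n (G * A * H) = vec_space.rank n A"
proof -
  obtain G' where G': "G' \<in> carrier_mat n n" "G' * G = 1\<^sub>m n"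
    using invertible_mat_obtain_inverse assms by metis
  obtain H' where H': "H' \<in> carrier_mat n n" "H * H' = 1\<^sub>m n"
    using invertible_mat_obtain_inverse assms by metis
  have "kernel.dim n (G * A * H) = kernel.dim n (G * A)"
    by (rule mat_kernel_dim_mult_eq_right[OF _ assms(3) H']) (use assms in auto)
  also have "\<dots> = kernel.dim n A"
    unfolding mat_kernel_mult_eq[OF assms(1,2) G'] ..
  finally show ?thesis
    using vec_space.rank_plus_kernel_dim[of "G * A * H" n n] vec_space.rank_plus_kernel_dim[OF assms(1)] assms
    by (metis add_right_cancel mult_carrier_mat)
qed

lemma rank_block_one:
  assumes S: "S \<in> carrier_mat n n"
  shows "vec_space.rank (m + n) (four_block_mat (1\<^sub>m m) (0\<^sub>m m n) (0\<^sub>m n m) S :: complex mat) =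
    m + vec_space.rank n S"
proof -
  let ?F = "four_block_mat (1\<^sub>m m) (0\<^sub>m m n) (0\<^sub>m n m) S"
  have "kernel.dim (m + n) ?F = kernel.dim m (1\<^sub>m m :: complex mat) + kernel.dim n S"
    by (rule kernel_four_block_0_mat[OF refl]) (use S in auto)
  then have "kernel.dim (m + n) ?F = kernel.dim n S" by (simp add: kernel_one_mat)
  moreover have "?F \<in> carrier_mat (m + n) (m + n)" using S by simp
  ultimately show ?thesis
    using vec_space.rank_plus_kernel_dim[of ?F "m + n" "m + n"] vec_space.rank_plus_kernel_dim[OF S] by simp
qed

lemma rank_eq_0_imp_zero:
  fixes S :: "complex mat"
  assumes S: "S \<in> carrier_mat r c" and "vec_space.rank r S = 0"
  shows "S = 0\<^sub>m r c"
proof -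
  interpret vec_space "TYPE(complex)" r .
  have "col S j = 0\<^sub>v r" if "j < c" for j
  proof (rule ccontr)
    assume "col S j \<noteq> 0\<^sub>v r"
    have "col S j \<in> set (cols S)" using that S by (metis carrier_matD(2) cols_length cols_nth nth_mem)
    have v: "col S j \<in> carrier_vec r" using S by auto
    have "a (col S j) = 0" if "lincomb a {col S j} = 0\<^sub>v r" for a
    proof -
      obtain i where i: "i < r" "col S j $ i \<noteq> 0"
        using \<open>col S j \<noteq> 0\<^sub>v r\<close> v by (metis eq_vecI carrier_vecD index_zero_vec)
      have "lincomb a {col S j} $ i = (\<Sum>x\<in>{col S j}. a x * x $ i)"
        by (rule lincomb_index) (use i v in auto)
      then show ?thesis using that i by simp
    qed
    then have "lin_indpt {col S j}"
      by (intro finite_lin_indpt2) (use v in auto)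
    have "card {col S j} \<le> rank S"
      by (rule rank_ge_card_indpt[OF S])
        (use \<open>col S j \<in> set (cols S)\<close> \<open>lin_indpt {col S j}\<close> in auto)
    then show False using assms(2) by simp
  qed
  note cols = this
  show ?thesis
  proof (rule eq_matI)
    fix i j assume "i < dim_row (0\<^sub>m r c :: complex mat)" "j < dim_col (0\<^sub>m r c :: complex mat)"
    then show "S $$ (i, j) = 0\<^sub>m r c $$ (i, j)"
      using arg_cong[OF cols[of j], of "\<lambda>v. v $ i"] S by simp
  qed (use S in auto)
qed

text \<open>
  If the columns of \<open>G\<close> span the whole space, then \<open>w = G x\<close> for some \<open>x\<close>, and \<open>G\<^sup>* G x = 0\<close>
  forces \<open>G x = 0\<close>.
\<close>

lemma full_rank_adjoint_inj:
  fixes G :: "complex mat"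
  assumes G: "G \<in> carrier_mat r c" and rk: "vec_space.rank r G = r"
    and w: "w \<in> carrier_vec r" "mat_adjoint G *\<^sub>v w = 0\<^sub>v c"
  shows "w = 0\<^sub>v r"
proof -
  interpret vec_space "TYPE(complex)" r .
  have "lin_indpt {}" by (rule finite_lin_indpt2) auto
  then obtain S where S: "maximal S (\<lambda>T. T \<subseteq> set (cols G) \<and> lin_indpt T)" "finite S"
    using maximal_exists_superset[of "set (cols G)" "\<lambda>T. T \<subseteq> set (cols G) \<and> lin_indpt T" "{}"]
    by auto
  then have "card S = r" "S \<subseteq> set (cols G)" "lin_indpt S"
    using rank_card_indpt[OF G S(1)] rk by (auto simp: maximal_def)
  have Gc: "set (cols G) \<subseteq> carrier_vec r" using G cols_dim by blast
  have "basis S"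
    by (rule dim_li_is_basis) (use \<open>card S = r\<close> \<open>S \<subseteq> set (cols G)\<close> \<open>lin_indpt S\<close> S(2) Gc in \<open>auto simp: dim_is_n\<close>)
  then have "span S = carrier_vec r" by (simp add: basis_def)
  then have "carrier_vec r \<subseteq> span (set (cols G))"
    using span_is_monotone[OF \<open>S \<subseteq> set (cols G)\<close>] by simp
  then have "w \<in> col_space G" using w(1) by (auto simp: col_space_def)
  then obtain x where x: "x \<in> carrier_vec c" "G *\<^sub>v x = w" unfolding col_space_eq[OF G] using G by auto
  have "(mat_adjoint G * G) *\<^sub>v x = 0\<^sub>v c"
    using w(2) G x by (subst assoc_mult_mat_vec[of _ c r]) auto
  then show ?thesis using gram_mult_vec_eq_0D[OF G x(1)] x(2) by simp
qed

section \<open>Matrices side by side\<close>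

lemma side_by_side_carrier [simp]:
  "A \<in> carrier_mat r c1 \<Longrightarrow> B \<in> carrier_mat r c2 \<Longrightarrow> side_by_side A B \<in> carrier_mat r (c1 + c2)"
  unfolding side_by_side_def carrier_mat_def by simp

lemma side_by_side_mult_four_block:
  assumes "A \<in> carrier_mat r m1" "B \<in> carrier_mat r m2"
    and "K \<in> carrier_mat m1 c1" "L \<in> carrier_mat m1 c2" "M \<in> carrier_mat m2 c1" "N \<in> carrier_mat m2 c2"
  shows "side_by_side A B * four_block_mat K L M N = side_by_side (A * K + B * M) (A * L + B * N)"
proof -
  have "side_by_side A B * four_block_mat K L M N =
    four_block_mat (A * K + B * M) (A * L + B * N) (0\<^sub>m 0 m1 * K + 0\<^sub>m 0 m2 * M) (0\<^sub>m 0 m1 * L + 0\<^sub>m 0 m2 * N)"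
    unfolding side_by_side_def
    by (subst mult_four_block_mat[of _ r m1 _ m2 _ 0 _ _ c1 _ c2]) (use assms in auto)
  also have "\<dots> = side_by_side (A * K + B * M) (A * L + B * N)"
    unfolding side_by_side_def using assms by (intro cong_four_block_mat) auto
  finally show ?thesis .
qed

lemma side_by_side_mult_block_diag:
  fixes A B K L :: "complex mat"
  assumes "A \<in> carrier_mat r m1" "B \<in> carrier_mat r m2" "K \<in> carrier_mat m1 c1" "L \<in> carrier_mat m2 c2"
  shows "side_by_side A B * four_block_mat K (0\<^sub>m m1 c2) (0\<^sub>m m2 c1) L = side_by_side (A * K) (B * L)"
  by (subst side_by_side_mult_four_block[of _ r m1 _ m2 _ c1 _ c2]) (use assms in auto)

lemma index_side_by_side:
  assumes "A \<in> carrier_mat r c1" "B \<in> carrier_mat r c2" "i < r" "j < c1 + c2"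
  shows "side_by_side A B $$ (i, j) = (if j < c1 then A $$ (i, j) else B $$ (i, j - c1))"
  using assms unfolding side_by_side_def by (subst index_mat_four_block) auto

lemma mult_side_by_side:
  assumes "U \<in> carrier_mat k r" "A \<in> carrier_mat r c1" "B \<in> carrier_mat r c2"
  shows "U * side_by_side A B = side_by_side (U * A) (U * B)"
proof (rule eq_matI)
  fix i j assume "i < dim_row (side_by_side (U * A) (U * B))" "j < dim_col (side_by_side (U * A) (U * B))"
  then have ij: "i < k" "j < c1 + c2" using assms by (auto simp: side_by_side_def)
  have "col (side_by_side A B) j = (if j < c1 then col A j else col B (j - c1))"
    using ij assms by (intro eq_vecI) (auto simp: index_side_by_side[OF assms(2,3)] side_by_side_def)
  then show "(U * side_by_side A B) $$ (i, j) = side_by_side (U * A) (U * B) $$ (i, j)"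
    using ij assms by (subst index_side_by_side[of _ k c1 _ c2]) (auto simp: side_by_side_def)
qed (use assms in \<open>auto simp: side_by_side_def\<close>)

lemma side_by_side_split:
  assumes "A \<in> carrier_mat r (c1 + c2)"
  obtains A1 A2 where "A1 \<in> carrier_mat r c1" "A2 \<in> carrier_mat r c2" "A = side_by_side A1 A2"
proof
  show "A = side_by_side (mat r c1 (\<lambda>ij. A $$ ij)) (mat r c2 (\<lambda>(i, j). A $$ (i, c1 + j)))"
    using assms by (intro eq_matI) (auto simp: side_by_side_def)
qed auto

lemma side_by_side_inject:
  assumes "side_by_side A B = side_by_side A' B'" "A \<in> carrier_mat r c1" "B \<in> carrier_mat r c2"
    "A' \<in> carrier_mat r c1" "B' \<in> carrier_mat r c2"
  shows "A = A'" "B = B'"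
  using four_block_mat_inject[OF assms(1)[unfolded side_by_side_def], of r c1 c2 0] assms(2-) by auto

lemma side_by_side_mult_adjoint:
  fixes A B A' B' :: "complex mat"
  assumes "A \<in> carrier_mat r c1" "B \<in> carrier_mat r c2" "A' \<in> carrier_mat r c1" "B' \<in> carrier_mat r c2"
  shows "side_by_side A B * mat_adjoint (side_by_side A' B') = A * mat_adjoint A' + B * mat_adjoint B'"
proof -
  have adj: "mat_adjoint (side_by_side A' B') =
    four_block_mat (mat_adjoint A') (0\<^sub>m c1 0) (mat_adjoint B') (0\<^sub>m c2 0)"
    using assms by (intro eq_matI) (auto simp: side_by_side_def)
  have "side_by_side A B * mat_adjoint (side_by_side A' B') =
    side_by_side (A * mat_adjoint A' + B * mat_adjoint B') (A * 0\<^sub>m c1 0 + B * 0\<^sub>m c2 0)"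
    unfolding adj by (rule side_by_side_mult_four_block[of _ r c1 _ c2 _ r _ 0]) (use assms in auto)
  also have "\<dots> = A * mat_adjoint A' + B * mat_adjoint B'"
    using assms by (intro eq_matI) (auto simp: side_by_side_def)
  finally show ?thesis .
qed

lemma diag_block_mat_four:
  assumes "V1 \<in> carrier_mat n n" "V2 \<in> carrier_mat n n" "V3 \<in> carrier_mat n n" "V4 \<in> carrier_mat n n"
  shows "diag_block_mat [V1, V2, V3, V4] =
    four_block_mat (four_block_mat V1 (0\<^sub>m n n) (0\<^sub>m n n) V2) (0\<^sub>m (n + n) (n + n)) (0\<^sub>m (n + n) (n + n))
      (four_block_mat V3 (0\<^sub>m n n) (0\<^sub>m n n) V4)"
proof -
  have "diag_block_mat [X, Y] = four_block_mat X (0\<^sub>m n n) (0\<^sub>m n n) Y"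
    if "X \<in> carrier_mat n n" "Y \<in> carrier_mat n n" for X Y :: "'a mat"
    using that diag_block_mat_append[of "[X]" "[Y]"] by (simp add: Let_def del: diag_block_mat.simps)
  then show ?thesis
    using diag_block_mat_append[of "[V1, V2]" "[V3, V4]"] assms
    by (simp add: Let_def del: diag_block_mat.simps)
qed

section \<open>Diagonalization of the boundary form\<close>

lemma add_uminus_mat:
  "A \<in> carrier_mat r c \<Longrightarrow> A + - A = (0\<^sub>m r c :: complex mat)"
  by (rule eq_matI) auto

lemma smult_smult_mat: "k \<cdot>\<^sub>m (l \<cdot>\<^sub>m A) = (k * l) \<cdot>\<^sub>m (A :: complex mat)"
  by (rule eq_matI) auto

lemma smult_mult_smult:
  assumes "A \<in> carrier_mat r k" "B \<in> carrier_mat k c"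
  shows "(x \<cdot>\<^sub>m A) * (y \<cdot>\<^sub>m B) = (x * y) \<cdot>\<^sub>m (A * B :: complex mat)"
  using mult_smult_assoc_mat[OF assms(1), of "y \<cdot>\<^sub>m B" c x] mult_smult_distrib[OF assms, of y] assms
  by (simp add: smult_smult_mat)

lemma C_mat_carrier [simp]: "C_mat m \<in> carrier_mat m m"
  by (simp add: C_mat_def)

lemma C_mat_dim [simp]: "dim_row (C_mat m) = m" "dim_col (C_mat m) = m"
  by (simp_all add: C_mat_def)

lemma C_mat_index:
  "i < m \<Longrightarrow> j < m \<Longrightarrow> C_mat m $$ (i, j) = (if i + j + 1 = m then (- 1) ^ Suc i else 0)"
proof -
  assume ij: "i < m" "j < m"
  then have "Suc i = m + 1 - Suc j \<longleftrightarrow> i + j + 1 = m" by arith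
  then show ?thesis unfolding C_mat_def by (simp only: index_mat(1)[OF ij] prod.case)
qed

lemma minus_one_power_square: "(- 1) ^ k * (- 1 :: complex) ^ k = 1"
  by (induction k) auto

lemma unitary_C_mat: "unitary_mat m (C_mat m)"
proof (rule unitary_matI)
  show "mat_adjoint (C_mat m) * C_mat m = 1\<^sub>m m"
  proof (rule eq_matI)
    fix i j assume "i < dim_row (1\<^sub>m m :: complex mat)" "j < dim_col (1\<^sub>m m :: complex mat)"
    then have ij: "i < m" "j < m" by auto
    have "(mat_adjoint (C_mat m) * C_mat m) $$ (i, j) =
      (\<Sum>l\<in>{0..<m}. cnj (C_mat m $$ (l, i)) * C_mat m $$ (l, j))"
      using ij by (auto simp: scalar_prod_def intro!: sum.cong)
    also have "\<dots> = (\<Sum>l\<in>{0..<m}. if l = m - 1 - i then (if i = j then 1 else 0) else 0)"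
      using ij by (intro sum.cong) (auto simp: C_mat_index minus_one_power_square)
    finally show "(mat_adjoint (C_mat m) * C_mat m) $$ (i, j) = 1\<^sub>m m $$ (i, j)"
      using ij by simp
  qed auto
qed simp

lemma adjoint_C_mat: "mat_adjoint (C_mat m) = (- 1) ^ (m + 1) \<cdot>\<^sub>m C_mat m"
proof (rule eq_matI)
  fix i j assume "i < dim_row ((- 1) ^ (m + 1) \<cdot>\<^sub>m C_mat m)" "j < dim_col ((- 1) ^ (m + 1) \<cdot>\<^sub>m C_mat m)"
  then have ij: "i < m" "j < m" by auto
  have "(- 1) ^ Suc j = (- 1) ^ (m + 1) * (- 1 :: complex) ^ Suc i" if "i + j + 1 = m"
  proof -
    have "(- 1) ^ (m + 1) * (- 1 :: complex) ^ Suc i = (- 1) ^ (Suc j + 2 * Suc i)"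
      unfolding power_add[symmetric] by (rule arg_cong[of _ _ "(^) (- 1)"]) (use that in simp)
    then show ?thesis unfolding power_add power_mult by simp
  qed
  then show "mat_adjoint (C_mat m) $$ (i, j) = ((- 1) ^ (m + 1) \<cdot>\<^sub>m C_mat m) $$ (i, j)"
    using ij by (auto simp: C_mat_index add.commute)
qed auto

text \<open>
  The unitary matrix that \<open>Z_mat\<close> applies to the second half of the quasi-derivatives.
\<close>

definition D_mat :: "nat \<Rightarrow> complex mat" where
  "D_mat n = ((- 1) ^ (n + 1) * \<i>) \<cdot>\<^sub>m C_mat n"

text \<open>
  Each of the two equal diagonal blocks of \<open>Z_mat\<close>.
\<close>

definition W_mat :: "nat \<Rightarrow> complex mat" where
  "W_mat n = complex_of_real (1 / sqrt 2) \<cdot>\<^sub>m four_block_mat (1\<^sub>m n) (D_mat n) (1\<^sub>m n) (- D_mat n)"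

definition J_mat :: "nat \<Rightarrow> complex mat" where
  "J_mat n = four_block_mat (1\<^sub>m n) (0\<^sub>m n n) (0\<^sub>m n n) (- 1\<^sub>m n)"

lemma D_mat_carrier [simp]: "D_mat n \<in> carrier_mat n n"
  by (simp add: D_mat_def)

lemma D_mat_dim [simp]: "dim_row (D_mat n) = n" "dim_col (D_mat n) = n"
  by (simp_all add: D_mat_def)

lemma W_mat_carrier [simp]: "W_mat n \<in> carrier_mat (n + n) (n + n)"
  by (simp add: W_mat_def)

lemma J_mat_carrier [simp]: "J_mat n \<in> carrier_mat (n + n) (n + n)"
  by (simp add: J_mat_def)

lemma unitary_D_mat: "unitary_mat n (D_mat n)"
proof (rule unitary_matI)
  let ?k = "(- 1) ^ (n + 1) * \<i>"
  have "cnj ?k * ?k = (- 1) ^ n * (- 1) ^ n" by (simp add: mult.left_commute mult.assoc)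
  then have k: "cnj ?k * ?k = 1" unfolding minus_one_power_square .
  have "mat_adjoint (D_mat n) * D_mat n = (cnj ?k * ?k) \<cdot>\<^sub>m (mat_adjoint (C_mat n) * C_mat n)"
    unfolding D_mat_def adjoint_smult
    by (rule smult_mult_smult) auto
  then show "mat_adjoint (D_mat n) * D_mat n = 1\<^sub>m n"
    unfolding k using unitary_matD(3)[OF unitary_C_mat, of n] by auto
qed simp

lemma half_sqrt2: "complex_of_real (1 / sqrt 2) * complex_of_real (1 / sqrt 2) = 1 / 2"
  unfolding of_real_mult[symmetric] by simp

lemma adjoint_W_mat: "mat_adjoint (W_mat n) = complex_of_real (1 / sqrt 2) \<cdot>\<^sub>m
    four_block_mat (1\<^sub>m n) (1\<^sub>m n) (mat_adjoint (D_mat n)) (- mat_adjoint (D_mat n))"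
  unfolding W_mat_def adjoint_smult
  by (subst adjoint_four_block[of _ n n _ n _ n]) auto

lemma unitary_W_mat: "unitary_mat (n + n) (W_mat n)"
proof -
  let ?s = "complex_of_real (1 / sqrt 2)"
  let ?F = "four_block_mat (1\<^sub>m n) (D_mat n) (1\<^sub>m n) (- D_mat n)"
  let ?F' = "four_block_mat (1\<^sub>m n) (1\<^sub>m n) (mat_adjoint (D_mat n)) (- mat_adjoint (D_mat n))"
  note D = unitary_matD[OF unitary_D_mat, of n]
  have "W_mat n * mat_adjoint (W_mat n) = (?s * ?s) \<cdot>\<^sub>m (?F * ?F')"
    unfolding adjoint_W_mat unfolding W_mat_def
    by (rule smult_mult_smult) auto
  also have "?F * ?F' = four_block_mat (1\<^sub>m n + 1\<^sub>m n) (0\<^sub>m n n) (0\<^sub>m n n) (1\<^sub>m n + 1\<^sub>m n)"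
    by (subst mult_four_block_mat[of _ n n _ n _ n _ _ n _ n]) (use D in \<open>auto simp: add_uminus_mat\<close>)
  also have "(?s * ?s) \<cdot>\<^sub>m \<dots> = 1\<^sub>m (n + n)"
    unfolding half_sqrt2 by (rule eq_matI) auto
  finally have "W_mat n * mat_adjoint (W_mat n) = 1\<^sub>m (n + n)" .
  then have "mat_adjoint (W_mat n) * W_mat n = 1\<^sub>m (n + n)"
    by (rule mat_mult_left_right_inverse[rotated 2]) auto
  then show ?thesis by (intro unitary_matI) auto
qed

lemma C_mat_double:
  "C_mat (n + n) = four_block_mat (0\<^sub>m n n) (C_mat n) ((- 1) ^ n \<cdot>\<^sub>m C_mat n) (0\<^sub>m n n)"
proof (rule eq_matI)
  fix i j
  let ?F = "four_block_mat (0\<^sub>m n n) (C_mat n) ((- 1) ^ n \<cdot>\<^sub>m C_mat n) (0\<^sub>m n n)"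
  assume "i < dim_row ?F" "j < dim_col ?F"
  then have ij: "i < n + n" "j < n + n" by auto
  have "(- 1) ^ n * (- 1) ^ (i - n) = (- 1 :: complex) ^ i" if "\<not> i < n"
    using that by (simp flip: power_add)
  then show "C_mat (n + n) $$ (i, j) = ?F $$ (i, j)"
    using ij by (auto simp: C_mat_index)
qed auto

text \<open>
  The columns of \<open>W\<^sup>*\<close> diagonalize the skew form \<open>C\<^sub>2\<^sub>n\<close>: up to the constant \<open>i (-1)\<^sup>n\<close> it has \<open>n\<close> positive and
  \<open>n\<close> negative squares. This is the reason for the shape of \<open>Z_mat\<close>.
\<close>

lemma C_mat_double_eq:
  "C_mat (n + n) = (\<i> * (- 1) ^ n) \<cdot>\<^sub>m (mat_adjoint (W_mat n) * J_mat n * W_mat n)"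
proof -
  let ?s = "complex_of_real (1 / sqrt 2)"
  let ?F = "four_block_mat (1\<^sub>m n) (D_mat n) (1\<^sub>m n) (- D_mat n)"
  let ?F' = "four_block_mat (1\<^sub>m n) (1\<^sub>m n) (mat_adjoint (D_mat n)) (- mat_adjoint (D_mat n))"
  note D = unitary_matD[OF unitary_D_mat, of n]
  have JF: "J_mat n * ?F = four_block_mat (1\<^sub>m n) (D_mat n) (- 1\<^sub>m n) (D_mat n)"
    unfolding J_mat_def by (subst mult_four_block_mat[of _ n n _ n _ n _ _ n _ n]) auto
  have F'JF: "?F' * (J_mat n * ?F) =
      four_block_mat (0\<^sub>m n n) (D_mat n + D_mat n) (mat_adjoint (D_mat n) + mat_adjoint (D_mat n)) (0\<^sub>m n n)"
    unfolding JF
    by (subst mult_four_block_mat[of _ n n _ n _ n _ _ n _ n]) (use D in \<open>auto simp: add_uminus_mat\<close>)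
  have JFc: "J_mat n * ?F \<in> carrier_mat (n + n) (n + n)" by (rule mult_carrier_mat[of _ _ "n + n"]) auto
  have "mat_adjoint (W_mat n) * J_mat n * W_mat n = mat_adjoint (W_mat n) * (J_mat n * W_mat n)"
    by (rule assoc_mult_mat[of _ "n + n" "n + n" _ "n + n" _ "n + n"]) auto
  also have "\<dots> = (?s * ?s) \<cdot>\<^sub>m (?F' * (J_mat n * ?F))"
    unfolding adjoint_W_mat unfolding W_mat_def
    by (subst mult_smult_distrib[of _ "n + n" "n + n" _ "n + n"], simp, simp,
        rule smult_mult_smult[of _ "n + n" "n + n" _ "n + n"]) (use JFc in auto)
  also have "\<dots> = four_block_mat (0\<^sub>m n n) (D_mat n) (mat_adjoint (D_mat n)) (0\<^sub>m n n)"
    unfolding F'JF half_sqrt2 by (rule eq_matI) auto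
  finally have WJW: "mat_adjoint (W_mat n) * J_mat n * W_mat n =
    four_block_mat (0\<^sub>m n n) (D_mat n) (mat_adjoint (D_mat n)) (0\<^sub>m n n)" .
  have D1: "(\<i> * (- 1) ^ n) \<cdot>\<^sub>m D_mat n = C_mat n"
    by (intro eq_matI) (auto simp: D_mat_def mult.assoc mult.left_commute minus_one_power_square)
  have D2: "(\<i> * (- 1) ^ n) \<cdot>\<^sub>m mat_adjoint (D_mat n) = (- 1) ^ n \<cdot>\<^sub>m C_mat n"
    unfolding D_mat_def adjoint_smult adjoint_C_mat
    by (intro eq_matI) (auto simp: mult.assoc mult.left_commute minus_one_power_square)
  show ?thesis
    unfolding WJW C_mat_double
    by (subst smult_four_block_mat[of _ n n _ n _ n]) (auto simp: D1 D2)
qed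

lemma Z_mat_block: "Z_mat n = four_block_mat (W_mat n) (0\<^sub>m (n + n) (n + n)) (0\<^sub>m (n + n) (n + n)) (W_mat n)"
proof -
  let ?N = "n + n"
  let ?H = "four_block_mat (1\<^sub>m n) (1\<^sub>m n) (1\<^sub>m n) (- 1\<^sub>m n) :: complex mat"
  let ?E = "four_block_mat (1\<^sub>m n) (0\<^sub>m n n) (0\<^sub>m n n) (D_mat n)"
  have two: "diag_block_mat [X, Y] = four_block_mat X (0\<^sub>m r s) (0\<^sub>m s r) Y"
    if "X \<in> carrier_mat r r" "Y \<in> carrier_mat s s" for X Y :: "complex mat" and r s
    using that diag_block_mat_append[of "[X]" "[Y]"] by (simp add: Let_def del: diag_block_mat.simps)
  have "diag_block_mat [1\<^sub>m n, D_mat n, 1\<^sub>m n, D_mat n] = four_block_mat ?E (0\<^sub>m ?N ?N) (0\<^sub>m ?N ?N) ?E"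
    using diag_block_mat_append[of "[1\<^sub>m n, D_mat n]" "[1\<^sub>m n, D_mat n]"]
    by (simp add: two[of _ n _ n] Let_def del: diag_block_mat.simps)
  moreover have "diag_block_mat [?H, ?H] = four_block_mat ?H (0\<^sub>m ?N ?N) (0\<^sub>m ?N ?N) ?H"
    by (rule two) auto
  moreover have "?H * ?E = four_block_mat (1\<^sub>m n) (D_mat n) (1\<^sub>m n) (- D_mat n)"
    by (subst mult_four_block_mat[of _ n n _ n _ n _ _ n _ n]) auto
  ultimately have "diag_block_mat [?H, ?H] * diag_block_mat [1\<^sub>m n, D_mat n, 1\<^sub>m n, D_mat n] =
    four_block_mat (four_block_mat (1\<^sub>m n) (D_mat n) (1\<^sub>m n) (- D_mat n)) (0\<^sub>m ?N ?N) (0\<^sub>m ?N ?N)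
      (four_block_mat (1\<^sub>m n) (D_mat n) (1\<^sub>m n) (- D_mat n))"
    by (simp add: mult_block_diag[of _ ?N _ ?N] del: diag_block_mat.simps)
  then show ?thesis
    unfolding Z_mat_def Let_def D_mat_def[symmetric] W_mat_def
    by (simp add: smult_four_block_mat[of _ ?N ?N _ ?N _ ?N] del: diag_block_mat.simps)
qed

text \<open>
  In the coordinates \<open>A W\<^sup>* = (A1 : A2)\<close> the two sides of the symmetry condition are differences of Gram matrices.
\<close>

lemma boundary_form_split:
  assumes A1: "A1 \<in> carrier_mat (n + n) n" and A2: "A2 \<in> carrier_mat (n + n) n"
    and A: "A = side_by_side A1 A2 * W_mat n"
  shows "A * C_mat (n + n) * mat_adjoint A =
      (\<i> * (- 1) ^ n) \<cdot>\<^sub>m (A1 * mat_adjoint A1 + - (A2 * mat_adjoint A2))"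
    and "A * mat_adjoint A = A1 * mat_adjoint A1 + A2 * mat_adjoint A2"
proof -
  let ?N = "n + n" and ?k = "\<i> * (- 1) ^ n" and ?W = "W_mat n" and ?J = "J_mat n"
  define G where "G = side_by_side A1 A2"
  have G: "G \<in> carrier_mat ?N ?N" unfolding G_def by (rule side_by_side_carrier[OF A1 A2])
  note W = unitary_matD[OF unitary_W_mat, of n]
  note J = J_mat_carrier[of n]
  note as = assoc_mult_mat[of _ ?N ?N _ ?N _ ?N]
  note mc = mult_carrier_mat[of _ ?N ?N _ ?N]
  have adjA: "mat_adjoint A = mat_adjoint ?W * mat_adjoint G"
    unfolding A G_def[symmetric] by (rule adjoint_mult[OF G W(1)])
  have adjG: "mat_adjoint G \<in> carrier_mat ?N ?N" using G by simp
  let ?X = "mat_adjoint ?W * ?J * ?W"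
  have X: "?X \<in> carrier_mat ?N ?N" by (intro mc W J)
  have "G * ?W * C_mat ?N = ?k \<cdot>\<^sub>m (G * ?W * ?X)"
    unfolding C_mat_double_eq by (rule mult_smult_distrib[OF mc[OF G W(1)] X])
  also have "G * ?W * ?X = G * ?J * ?W"
  proof -
    have "G * ?W * ?X = G * (?W * (mat_adjoint ?W * (?J * ?W)))"
      by (simp add: as[OF W(2) J W(1)] as[OF G W(1) mc[OF W(2) mc[OF J W(1)]]])
    also have "\<dots> = G * (?J * ?W)"
      by (simp add: unitary_cancel(2)[OF unitary_W_mat mc[OF J W(1)]])
    also have "\<dots> = G * ?J * ?W" by (rule as[OF G J W(1), symmetric])
    finally show ?thesis .
  qed
  finally have "G * ?W * C_mat ?N * mat_adjoint A = ?k \<cdot>\<^sub>m (G * ?J * ?W * (mat_adjoint ?W * mat_adjoint G))"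
    unfolding adjA by (simp add: mult_smult_assoc_mat[OF mc[OF mc[OF G J] W(1)] mc[OF W(2) adjG]])
  also have "G * ?J * ?W * (mat_adjoint ?W * mat_adjoint G) = G * ?J * mat_adjoint G"
    by (simp add: as[OF mc[OF G J] W(1) mc[OF W(2) adjG]] unitary_cancel(2)[OF unitary_W_mat adjG])
  also have "G * ?J = side_by_side A1 (- A2)"
    unfolding G_def J_mat_def
    by (subst side_by_side_mult_four_block[of _ ?N n _ n _ n _ n]) (use A1 A2 in auto)
  also have "side_by_side A1 (- A2) * mat_adjoint G = A1 * mat_adjoint A1 + - A2 * mat_adjoint A2"
    unfolding G_def by (rule side_by_side_mult_adjoint) (use A1 A2 in auto)
  also have "- A2 * mat_adjoint A2 = - (A2 * mat_adjoint A2)"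
    by (rule uminus_mult_left_mat) (use A2 in auto)
  finally show "A * C_mat ?N * mat_adjoint A = ?k \<cdot>\<^sub>m (A1 * mat_adjoint A1 + - (A2 * mat_adjoint A2))"
    unfolding A G_def .
  have "A * mat_adjoint A = G * ?W * (mat_adjoint ?W * mat_adjoint G)"
    unfolding adjA unfolding A G_def ..
  also have "\<dots> = G * mat_adjoint G"
    by (simp add: as[OF G W(1) mc[OF W(2) adjG]] unitary_cancel(2)[OF unitary_W_mat adjG])
  also have "\<dots> = A1 * mat_adjoint A1 + A2 * mat_adjoint A2"
    unfolding G_def by (rule side_by_side_mult_adjoint[OF A1 A2 A1 A2])
  finally show "A * mat_adjoint A = A1 * mat_adjoint A1 + A2 * mat_adjoint A2" .
qed

section \<open>Factorization of boundary conditions and their type\<close>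

text \<open>
  A vector \<open>w\<close> in the kernel of \<open>P\<^sup>*\<close> is killed by \<open>P P\<^sup>* + Q Q\<^sup>* = G G\<^sup>*\<close> with \<open>G = (A : B)\<close>, hence by \<open>G\<^sup>*\<close>,
  and is zero because \<open>G\<close> has full row rank.
\<close>

lemma det_nonzero_if_gram_split:
  fixes P Q A B :: "complex mat"
  assumes P: "P \<in> carrier_mat r r" and Q: "Q \<in> carrier_mat r r"
    and A: "A \<in> carrier_mat r c" and B: "B \<in> carrier_mat r c"
    and rank: "vec_space.rank r (side_by_side A B) = r"
    and gram: "A * mat_adjoint A + B * mat_adjoint B = P * mat_adjoint P + Q * mat_adjoint Q"
    and PQ: "P * mat_adjoint P = Q * mat_adjoint Q"
  shows "det P \<noteq> 0"
proof
  assume "det P = 0"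
  then have "det (mat_adjoint P) = 0" by (rule det_adjoint_eq_0[OF P])
  then obtain w where w: "w \<in> carrier_vec r" "w \<noteq> 0\<^sub>v r" "mat_adjoint P *\<^sub>v w = 0\<^sub>v r"
    using det_0_iff_vec_prod_zero_field[of "mat_adjoint P" r] P by auto
  let ?G = "side_by_side A B"
  have G: "?G \<in> carrier_mat r (c + c)" by (rule side_by_side_carrier[OF A B])
  have "(P * mat_adjoint P) *\<^sub>v w = P *\<^sub>v (mat_adjoint P *\<^sub>v w)"
    by (rule assoc_mult_mat_vec) (use P w in auto)
  then have Pw: "(P * mat_adjoint P) *\<^sub>v w = 0\<^sub>v r" unfolding w(3) using P by (intro eq_vecI) auto
  have "?G * mat_adjoint ?G = P * mat_adjoint P + P * mat_adjoint P"
    using side_by_side_mult_adjoint[OF A B A B] gram PQ by simp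
  moreover have "(P * mat_adjoint P + P * mat_adjoint P) *\<^sub>v w = 0\<^sub>v r"
    by (subst add_mult_distrib_mat_vec[of _ r r]) (use Pw P w in auto)
  ultimately have "(mat_adjoint (mat_adjoint ?G) * mat_adjoint ?G) *\<^sub>v w = 0\<^sub>v r" by simp
  then have "mat_adjoint ?G *\<^sub>v w = 0\<^sub>v (c + c)"
    by (rule gram_mult_vec_eq_0D[rotated 2]) (use G w in auto)
  then show False using full_rank_adjoint_inj[OF G rank w(1)] w(2) by simp
qed

text \<open>
  With \<open>A W\<^sup>* = (A1 : A2)\<close> and \<open>B W\<^sup>* = (B1 : B2)\<close>, the positive parts of \<open>A\<close> and the negative parts of \<open>B\<close> are
  collected in \<open>P = (A1 : B2)\<close>, the other two in \<open>Q = (A2 : B1)\<close>. The symmetry condition then says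
  \<open>P P\<^sup>* = Q Q\<^sup>*\<close>, and \<open>Y = Q\<inverse> P\<close> is unitary. Its CS decomposition and \<open>U = Q diag(U1, U2)\<close> give

  \<open>(A2 : B1) = U diag(U1\<^sup>*, U2\<^sup>*)\<close>  and  \<open>(A1 : B2) = U (C, S; -S, C) diag(V1, V2)\<close>,

  which is the assertion after sorting the block columns back.
\<close>

lemma boundary_pair_decomposition:
  fixes A B :: "complex mat"
  assumes A: "A \<in> carrier_mat (n + n) (n + n)" and B: "B \<in> carrier_mat (n + n) (n + n)"
    and rank: "vec_space.rank (n + n) (side_by_side A B) = n + n"
    and form: "A * C_mat (n + n) * mat_adjoint A = B * C_mat (n + n) * mat_adjoint B"
  obtains U V1 U1 U2 V2 c s where
    "U \<in> carrier_mat (n + n) (n + n)" "invertible_mat U"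
    "unitary_mat n V1" "unitary_mat n U1" "unitary_mat n U2" "unitary_mat n V2"
    "\<And>i. i < n \<Longrightarrow> c i \<ge> 0" "\<And>i. i < n \<Longrightarrow> s i \<ge> 0" "\<And>i. i < n \<Longrightarrow> (c i)\<^sup>2 + (s i)\<^sup>2 = 1"
    "A = U * four_block_mat (real_diag n c) (1\<^sub>m n) (- real_diag n s) (0\<^sub>m n n) *
      (four_block_mat V1 (0\<^sub>m n n) (0\<^sub>m n n) (mat_adjoint U1) * W_mat n)"
    "B = U * four_block_mat (0\<^sub>m n n) (real_diag n s) (1\<^sub>m n) (real_diag n c) *
      (four_block_mat (mat_adjoint U2) (0\<^sub>m n n) (0\<^sub>m n n) V2 * W_mat n)"
proof -
  let ?N = "n + n" and ?W = "W_mat n"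
  note W = unitary_matD[OF unitary_W_mat, of n]
  note as = assoc_mult_mat[of _ ?N ?N _ ?N _ ?N]
  note m4 = mult_four_block_mat[of _ n n _ n _ n _ _ n _ n]
  note sm = side_by_side_mult_four_block[of _ ?N n _ n _ n _ n]
  obtain A1 A2 where A1: "A1 \<in> carrier_mat ?N n" and A2: "A2 \<in> carrier_mat ?N n"
    and "A * mat_adjoint ?W = side_by_side A1 A2"
    using side_by_side_split[of "A * mat_adjoint ?W" ?N n n] A W by auto
  then have Aeq: "A = side_by_side A1 A2 * ?W"
    using A W by (metis as right_mult_one_mat)
  obtain B1 B2 where B1: "B1 \<in> carrier_mat ?N n" and B2: "B2 \<in> carrier_mat ?N n"
    and "B * mat_adjoint ?W = side_by_side B1 B2"
    using side_by_side_split[of "B * mat_adjoint ?W" ?N n n] B W by auto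
  then have Beq: "B = side_by_side B1 B2 * ?W"
    using B W by (metis as right_mult_one_mat)
  define P where "P = side_by_side A1 B2"
  define Q where "Q = side_by_side A2 B1"
  have P: "P \<in> carrier_mat ?N ?N" unfolding P_def by (rule side_by_side_carrier[OF A1 B2])
  have Q: "Q \<in> carrier_mat ?N ?N" unfolding Q_def by (rule side_by_side_carrier[OF A2 B1])
  have PP: "P * mat_adjoint P = A1 * mat_adjoint A1 + B2 * mat_adjoint B2"
    unfolding P_def by (rule side_by_side_mult_adjoint[OF A1 B2 A1 B2])
  have QQ: "Q * mat_adjoint Q = A2 * mat_adjoint A2 + B1 * mat_adjoint B1"
    unfolding Q_def by (rule side_by_side_mult_adjoint[OF A2 B1 A2 B1])
  define X1 X2 Y1 Y2 where "X1 = A1 * mat_adjoint A1" and "X2 = A2 * mat_adjoint A2"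
    and "Y1 = B1 * mat_adjoint B1" and "Y2 = B2 * mat_adjoint B2"
  have X: "X1 \<in> carrier_mat ?N ?N" "X2 \<in> carrier_mat ?N ?N" "Y1 \<in> carrier_mat ?N ?N" "Y2 \<in> carrier_mat ?N ?N"
    using A1 A2 B1 B2 by (simp_all add: X1_def X2_def Y1_def Y2_def)
  have eq: "(\<i> * (- 1) ^ n) \<cdot>\<^sub>m (X1 + - X2) = (\<i> * (- 1) ^ n) \<cdot>\<^sub>m (Y1 + - Y2)"
    using form boundary_form_split(1)[OF A1 A2 Aeq] boundary_form_split(1)[OF B1 B2 Beq]
    by (simp add: X1_def X2_def Y1_def Y2_def)
  have PPQQ: "P * mat_adjoint P = Q * mat_adjoint Q"
    unfolding PP QQ X1_def[symmetric] X2_def[symmetric] Y1_def[symmetric] Y2_def[symmetric]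
  proof (rule eq_matI)
    fix i j assume "i < dim_row (X2 + Y1)" "j < dim_col (X2 + Y1)"
    then have ij: "i < ?N" "j < ?N" using X by auto
    have "X1 $$ (i, j) - X2 $$ (i, j) = Y1 $$ (i, j) - Y2 $$ (i, j)"
      using arg_cong[OF eq, of "\<lambda>M. M $$ (i, j)"] ij X by simp
    then show "(X1 + Y2) $$ (i, j) = (X2 + Y1) $$ (i, j)"
      using ij X by (simp add: algebra_simps)
  qed (use X in auto)
  have gram: "A * mat_adjoint A + B * mat_adjoint B = P * mat_adjoint P + Q * mat_adjoint Q"
    unfolding PP QQ boundary_form_split(2)[OF A1 A2 Aeq] boundary_form_split(2)[OF B1 B2 Beq]
      X1_def[symmetric] X2_def[symmetric] Y1_def[symmetric] Y2_def[symmetric]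
    using X by (intro eq_matI) auto
  have "det Q \<noteq> 0"
  proof (rule det_nonzero_if_gram_split[OF Q P A B rank])
    show "A * mat_adjoint A + B * mat_adjoint B = Q * mat_adjoint Q + P * mat_adjoint P"
      using gram PPQQ by simp
  qed (simp add: PPQQ)
  then obtain R where R: "R \<in> carrier_mat ?N ?N" "Q * R = 1\<^sub>m ?N" "R * Q = 1\<^sub>m ?N"
    using det_nonzero_obtain_inverse[OF Q] by blast
  define Y where "Y = R * P"
  have Y: "Y \<in> carrier_mat ?N ?N" using R P by (simp add: Y_def)
  have QY: "Q * Y = P"
    unfolding Y_def using as[OF Q R(1) P] R(2) P by simp
  have "Y * mat_adjoint Y = R * (P * mat_adjoint P) * mat_adjoint R"
    using R P by (simp add: Y_def adjoint_mult[of _ ?N ?N _ ?N] as)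
  also have "\<dots> = (R * Q) * mat_adjoint (R * Q)"
    unfolding PPQQ using R(1) Q by (simp add: adjoint_mult[of _ ?N ?N _ ?N] as)
  also have "\<dots> = 1\<^sub>m ?N" unfolding R(3) by simp
  finally have "unitary_mat ?N (mat_adjoint Y)" using Y by (intro unitary_matI) auto
  then have Yu: "unitary_mat ?N Y" using unitary_mat_adjoint by fastforce
  obtain Y11 Y12 Y21 Y22 where sb: "split_block Y n n = (Y11, Y12, Y21, Y22)"
    by (cases "split_block Y n n") auto
  note Yb = split_block[OF sb, of n n, OF carrier_matD[OF Y]]
  obtain U1 U2 V1 V2 c s where U1: "unitary_mat n U1" and U2: "unitary_mat n U2"
    and V1: "unitary_mat n V1" and V2: "unitary_mat n V2"
    and cs: "\<And>i. i < n \<Longrightarrow> c i \<ge> 0" "\<And>i. i < n \<Longrightarrow> s i \<ge> 0" "\<And>i. i < n \<Longrightarrow> (c i)\<^sup>2 + (s i)\<^sup>2 = 1"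
    and Y11: "Y11 = U1 * real_diag n c * V1" and Y12: "Y12 = U1 * real_diag n s * V2"
    and Y21: "Y21 = - (U2 * real_diag n s * V1)" and Y22: "Y22 = U2 * real_diag n c * V2"
    using cs_decomposition[OF Yb(1-4) Yu[unfolded Yb(5)]] by metis
  note u = unitary_matD[OF U1] unitary_matD[OF U2] unitary_matD[OF V1] unitary_matD[OF V2]
  define C where "C = real_diag n c"
  define S where "S = real_diag n s"
  have C: "C \<in> carrier_mat n n" and S: "S \<in> carrier_mat n n" by (simp_all add: C_def S_def)
  let ?E = "four_block_mat U1 (0\<^sub>m n n) (0\<^sub>m n n) U2"
  have Eu: "unitary_mat ?N ?E" by (rule unitary_block_diag[OF U1 U2])
  note E = unitary_matD[OF Eu]
  have adjE: "mat_adjoint ?E = four_block_mat (mat_adjoint U1) (0\<^sub>m n n) (0\<^sub>m n n) (mat_adjoint U2)"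
    by (subst adjoint_four_block[of _ n n _ n _ n]) (use u in auto)
  define U where "U = Q * ?E"
  have U: "U \<in> carrier_mat ?N ?N" using Q E by (simp add: U_def)
  have "U * (mat_adjoint ?E * R) = Q * (?E * (mat_adjoint ?E * R))"
    unfolding U_def using Q E(1,2) R(1) by (simp add: as)
  then have "U * (mat_adjoint ?E * R) = 1\<^sub>m ?N"
    using unitary_cancel(2)[OF Eu R(1)] R(2) by simp
  then have Uinv: "invertible_mat U"
    by (rule invertible_matI[rotated 2]) (use U E(2) R(1) in auto)
  obtain Ua Ub where Ua: "Ua \<in> carrier_mat ?N n" and Ub: "Ub \<in> carrier_mat ?N n"
    and Uab: "U = side_by_side Ua Ub"
    using side_by_side_split[OF U] by blast
  have "side_by_side A2 B1 = U * mat_adjoint ?E"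
    unfolding U_def Q_def[symmetric] using Q E by (simp add: as)
  also have "\<dots> = side_by_side (Ua * mat_adjoint U1) (Ub * mat_adjoint U2)"
    unfolding Uab adjE by (subst sm) (use Ua Ub u in auto)
  finally have A2eq: "A2 = Ua * mat_adjoint U1" and B1eq: "B1 = Ub * mat_adjoint U2"
    using side_by_side_inject[of A2 B1 _ _ ?N n n] A2 B1 Ua Ub u by auto
  have EY: "mat_adjoint ?E * Y = four_block_mat (C * V1) (S * V2) (- (S * V1)) (C * V2)"
  proof -
    have c1: "mat_adjoint U1 * (U1 * M * M') = M * M'"
      if "M \<in> carrier_mat n n" "M' \<in> carrier_mat n n" for M M'
      using that u by (simp add: assoc_mult_mat[of _ n n _ n _ n] unitary_cancel[OF U1, of _ n])
    have c2: "mat_adjoint U2 * (U2 * M * M') = M * M'"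
      if "M \<in> carrier_mat n n" "M' \<in> carrier_mat n n" for M M'
      using that u by (simp add: assoc_mult_mat[of _ n n _ n _ n] unitary_cancel[OF U2, of _ n])
    have c3: "mat_adjoint U2 * - (U2 * S * V1) = - (S * V1)"
      using c2[OF S, of V1] u S uminus_mult_right_mat[of "mat_adjoint U2" "U2 * S * V1"] by simp
    show ?thesis
      unfolding adjE Yb(5) Y11 Y12 Y21 Y22 C_def[symmetric] S_def[symmetric]
      by (subst m4) (use u C S c1 c2 c3 in auto)
  qed
  have "side_by_side A1 B2 = U * (mat_adjoint ?E * Y)"
    unfolding U_def P_def[symmetric] using Q E Y QY by (simp add: as unitary_cancel(2)[OF Eu Y])
  also have "\<dots> = side_by_side (Ua * (C * V1) + Ub * - (S * V1)) (Ua * (S * V2) + Ub * (C * V2))"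
    unfolding Uab EY by (subst sm) (use Ua Ub u C S in auto)
  finally have A1eq: "A1 = Ua * (C * V1) + Ub * - (S * V1)" and B2eq: "B2 = Ua * (S * V2) + Ub * (C * V2)"
    using side_by_side_inject[of A1 B2 _ _ ?N n n] A1 B2 Ua Ub u C S by auto
  let ?KA = "four_block_mat C (1\<^sub>m n) (- S) (0\<^sub>m n n)"
  let ?KB = "four_block_mat (0\<^sub>m n n) S (1\<^sub>m n) C"
  let ?DA = "four_block_mat V1 (0\<^sub>m n n) (0\<^sub>m n n) (mat_adjoint U1)"
  let ?DB = "four_block_mat (mat_adjoint U2) (0\<^sub>m n n) (0\<^sub>m n n) V2"
  have carr: "?KA \<in> carrier_mat ?N ?N" "?KB \<in> carrier_mat ?N ?N" "?DA \<in> carrier_mat ?N ?N" "?DB \<in> carrier_mat ?N ?N"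
    using C S u by simp_all
  have reassoc: "U * (K * D) * M = U * K * (D * M)"
    if "K \<in> carrier_mat ?N ?N" "D \<in> carrier_mat ?N ?N" "M \<in> carrier_mat ?N ?N" for K D M
    using U that by (simp add: as)
  have "?KA * ?DA = four_block_mat (C * V1) (mat_adjoint U1) (- (S * V1)) (0\<^sub>m n n)"
    by (subst m4) (use C S u in auto)
  then have "U * (?KA * ?DA) = side_by_side A1 A2"
    unfolding Uab A1eq A2eq by simp (subst sm, use Ua Ub C S u in auto)
  then have Afin: "A = U * ?KA * (?DA * ?W)"
    unfolding Aeq using reassoc[OF carr(1,3) W(1)] by simp
  have "?KB * ?DB = four_block_mat (0\<^sub>m n n) (S * V2) (mat_adjoint U2) (C * V2)"
    by (subst m4) (use C S u in auto)
  then have "U * (?KB * ?DB) = side_by_side B1 B2"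
    unfolding Uab B1eq B2eq by simp (subst sm, use Ua Ub C S u in auto)
  then have Bfin: "B = U * ?KB * (?DB * ?W)"
    unfolding Beq using reassoc[OF carr(2,4) W(1)] by simp
  show thesis
    by (rule that[OF U Uinv V1 U1 U2 V2 _ _ _ Afin[unfolded C_def S_def] Bfin[unfolded C_def S_def]])
      (rule cs; assumption)+
qed

text \<open>
  For the block columns of the CS matrix that belong to \<open>A\<close> and to \<open>B\<close>, one has

  \<open>(C, I; -S, 0) = (I, 0; 0, S) (C, I; -I, 0)\<close>  and

  \<open>(0, S; I, C) = (0, I; I, 0) (I, 0; 0, S) (I, C; 0, I)\<close>,

  where the semicolons separate block rows. All factors except \<open>(I, 0; 0, S)\<close> are invertible, so the common
  rank of \<open>A\<close> and \<open>B\<close> is \<open>n + rank S\<close>.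
\<close>

lemma rank_cs_factors:
  fixes U M C S :: "complex mat"
  assumes U: "U \<in> carrier_mat (n + n) (n + n)" "invertible_mat U"
    and M: "M \<in> carrier_mat (n + n) (n + n)" "invertible_mat M"
    and C: "C \<in> carrier_mat n n" and S: "S \<in> carrier_mat n n"
  shows "vec_space.rank (n + n) (U * four_block_mat C (1\<^sub>m n) (- S) (0\<^sub>m n n) * M) = n + vec_space.rank n S"
    and "vec_space.rank (n + n) (U * four_block_mat (0\<^sub>m n n) S (1\<^sub>m n) C * M) = n + vec_space.rank n S"
proof -
  let ?N = "n + n"
  let ?F = "four_block_mat (1\<^sub>m n) (0\<^sub>m n n) (0\<^sub>m n n) S"
  let ?K = "four_block_mat C (1\<^sub>m n) (- 1\<^sub>m n) (0\<^sub>m n n)"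
  let ?T = "four_block_mat (0\<^sub>m n n) (1\<^sub>m n) (1\<^sub>m n) (0\<^sub>m n n) :: complex mat"
  let ?L = "four_block_mat (1\<^sub>m n) C (0\<^sub>m n n) (1\<^sub>m n)"
  note m4 = mult_four_block_mat[of _ n n _ n _ n _ _ n _ n]
  note as = assoc_mult_mat[of _ ?N ?N _ ?N _ ?N]
  have F: "?F \<in> carrier_mat ?N ?N" using S by simp
  have K: "?K \<in> carrier_mat ?N ?N" "invertible_mat ?K"
  proof -
    show "?K \<in> carrier_mat ?N ?N" using C by simp
    have "?K * four_block_mat (0\<^sub>m n n) (- 1\<^sub>m n) (1\<^sub>m n) C = 1\<^sub>m ?N"
      by (subst m4) (use C in \<open>auto simp flip: four_block_one_mat\<close>)
    then show "invertible_mat ?K" by (rule invertible_matI[rotated 2]) (use C in auto)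
  qed
  have T: "?T \<in> carrier_mat ?N ?N" "invertible_mat ?T"
  proof -
    show "?T \<in> carrier_mat ?N ?N" by simp
    have "?T * ?T = 1\<^sub>m ?N" by (subst m4) (auto simp flip: four_block_one_mat)
    then show "invertible_mat ?T" by (rule invertible_matI[rotated 2]) auto
  qed
  have L: "?L \<in> carrier_mat ?N ?N" "invertible_mat ?L"
  proof -
    show "?L \<in> carrier_mat ?N ?N" by simp
    have "?L * four_block_mat (1\<^sub>m n) (- C) (0\<^sub>m n n) (1\<^sub>m n) = 1\<^sub>m ?N"
      by (subst m4) (use C in \<open>auto simp flip: four_block_one_mat\<close>)
    then show "invertible_mat ?L" by (rule invertible_matI[rotated 2]) auto
  qed
  have "four_block_mat C (1\<^sub>m n) (- S) (0\<^sub>m n n) = ?F * ?K"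
    by (subst m4) (use C S in auto)
  then have "U * four_block_mat C (1\<^sub>m n) (- S) (0\<^sub>m n n) * M = U * ?F * (?K * M)"
    using U(1) M(1) F K(1) by (simp add: as)
  then show "vec_space.rank ?N (U * four_block_mat C (1\<^sub>m n) (- S) (0\<^sub>m n n) * M) = n + vec_space.rank n S"
    using rank_mult_invertible[OF F U(1) mult_carrier_mat[OF K(1) M(1)] U(2) invertible_mat_mult[OF K(1) M(1) K(2) M(2)]]
      rank_block_one[OF S, of n] by simp
  have "?F * ?L = four_block_mat (1\<^sub>m n) C (0\<^sub>m n n) S"
    by (subst m4) (use C S in auto)
  then have "?T * (?F * ?L) = four_block_mat (0\<^sub>m n n) S (1\<^sub>m n) C"
    by simp (subst m4, use C S in auto)
  moreover have "U * (T * (F * L)) * M = (U * T) * F * (L * M)"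
    if "T \<in> carrier_mat ?N ?N" "F \<in> carrier_mat ?N ?N" "L \<in> carrier_mat ?N ?N" for T F L
    using U(1) M(1) that by (simp add: as)
  note this[OF T(1) F L(1)]
  ultimately have "U * four_block_mat (0\<^sub>m n n) S (1\<^sub>m n) C * M = (U * ?T) * ?F * (?L * M)"
    by simp
  then show "vec_space.rank ?N (U * four_block_mat (0\<^sub>m n n) S (1\<^sub>m n) C * M) = n + vec_space.rank n S"
    using rank_mult_invertible[OF F mult_carrier_mat[OF U(1) T(1)] mult_carrier_mat[OF L(1) M(1)]
        invertible_mat_mult[OF U(1) T(1) U(2) T(2)] invertible_mat_mult[OF L(1) M(1) L(2) M(2)]]
      rank_block_one[OF S, of n] by simp
qed

theorem theorem5p2:
  fixes n :: nat and A B :: "complex mat"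
  assumes "n > 0"
    and "A \<in> carrier_mat (2 * n) (2 * n)" and "B \<in> carrier_mat (2 * n) (2 * n)"
    and "vec_space.rank (2 * n) (side_by_side A B) = 2 * n"
    and "A * C_mat (2 * n) * mat_adjoint A = B * C_mat (2 * n) * mat_adjoint B"
  shows "\<exists>U V1 U1 U2 V2 C S :: complex mat.
      U \<in> carrier_mat (2 * n) (2 * n) \<and> invertible_mat U \<and>
      unitary_mat n V1 \<and> unitary_mat n (mat_adjoint U1) \<and>
      unitary_mat n (mat_adjoint U2) \<and> unitary_mat n V2 \<and>
      pos_semidef_mat n C \<and> diagonal_mat C \<and>
      pos_semidef_mat n S \<and> diagonal_mat S \<and>
      C * C + S * S = 1\<^sub>m n \<and>
      side_by_side A B =
        U * CS_block_mat n C S *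
          diag_block_mat [V1, mat_adjoint U1, mat_adjoint U2, V2] * Z_mat n \<and>
      (separated_bc n A B \<longleftrightarrow> S = 0\<^sub>m n n) \<and>
      (mixed_bc n A B \<longleftrightarrow> 0 < vec_space.rank n S \<and> vec_space.rank n S < n) \<and>
      (coupled_bc n A B \<longleftrightarrow> vec_space.rank n S = n)"
proof -
  let ?N = "n + n"
  note A = assms(2)[unfolded mult_2] and B = assms(3)[unfolded mult_2]
  obtain U V1 U1 U2 V2 c s where U: "U \<in> carrier_mat ?N ?N" "invertible_mat U"
    and V1: "unitary_mat n V1" and U1: "unitary_mat n U1"
    and U2: "unitary_mat n U2" and V2: "unitary_mat n V2"
    and c: "\<And>i. i < n \<Longrightarrow> c i \<ge> 0" and s: "\<And>i. i < n \<Longrightarrow> s i \<ge> 0"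
    and cs: "\<And>i. i < n \<Longrightarrow> (c i)\<^sup>2 + (s i)\<^sup>2 = 1"
    and Aeq: "A = U * four_block_mat (real_diag n c) (1\<^sub>m n) (- real_diag n s) (0\<^sub>m n n) *
      (four_block_mat V1 (0\<^sub>m n n) (0\<^sub>m n n) (mat_adjoint U1) * W_mat n)"
    and Beq: "B = U * four_block_mat (0\<^sub>m n n) (real_diag n s) (1\<^sub>m n) (real_diag n c) *
      (four_block_mat (mat_adjoint U2) (0\<^sub>m n n) (0\<^sub>m n n) V2 * W_mat n)"
    using boundary_pair_decomposition[OF A B assms(4,5)[unfolded mult_2]] by metis
  define C where "C = real_diag n c"
  define S where "S = real_diag n s"
  note u = unitary_matD[OF U1] unitary_matD[OF U2] unitary_matD[OF V1] unitary_matD[OF V2]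
  have C: "C \<in> carrier_mat n n" and S: "S \<in> carrier_mat n n" by (simp_all add: C_def S_def)
  let ?KA = "four_block_mat C (1\<^sub>m n) (- S) (0\<^sub>m n n)"
  let ?KB = "four_block_mat (0\<^sub>m n n) S (1\<^sub>m n) C"
  let ?DA = "four_block_mat V1 (0\<^sub>m n n) (0\<^sub>m n n) (mat_adjoint U1)"
  let ?DB = "four_block_mat (mat_adjoint U2) (0\<^sub>m n n) (0\<^sub>m n n) V2"
  note W = unitary_matD(1)[OF unitary_W_mat, of n]
  have KA: "?KA \<in> carrier_mat ?N ?N" and KB: "?KB \<in> carrier_mat ?N ?N" using C S by simp_all
  have DAu: "unitary_mat ?N ?DA" and DBu: "unitary_mat ?N ?DB"
    using unitary_block_diag V1 V2 unitary_mat_adjoint[OF U1] unitary_mat_adjoint[OF U2] by auto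
  note DA = unitary_matD(1)[OF DAu] and DB = unitary_matD(1)[OF DBu]
  note mc = mult_carrier_mat[of _ ?N ?N _ ?N]
  have "U * CS_block_mat n C S = side_by_side (U * ?KA) (U * ?KB)"
    unfolding CS_block_mat_def by (rule mult_side_by_side[OF U(1) KA KB])
  moreover have "diag_block_mat [V1, mat_adjoint U1, mat_adjoint U2, V2] =
      four_block_mat ?DA (0\<^sub>m ?N ?N) (0\<^sub>m ?N ?N) ?DB"
    by (rule diag_block_mat_four) (use u in auto)
  ultimately have "U * CS_block_mat n C S * diag_block_mat [V1, mat_adjoint U1, mat_adjoint U2, V2] * Z_mat n =
      side_by_side (U * ?KA * ?DA * W_mat n) (U * ?KB * ?DB * W_mat n)"
    unfolding Z_mat_block
    using side_by_side_mult_block_diag[OF mc[OF U(1) KA] mc[OF U(1) KB] DA DB]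
      side_by_side_mult_block_diag[OF mc[OF mc[OF U(1) KA] DA] mc[OF mc[OF U(1) KB] DB] W W]
    by (simp del: diag_block_mat.simps)
  moreover have "U * ?KA * ?DA * W_mat n = A"
    unfolding Aeq C_def[symmetric] S_def[symmetric] by (rule assoc_mult_mat[OF mc[OF U(1) KA] DA W])
  moreover have "U * ?KB * ?DB * W_mat n = B"
    unfolding Beq C_def[symmetric] S_def[symmetric] by (rule assoc_mult_mat[OF mc[OF U(1) KB] DB W])
  ultimately have factor: "side_by_side A B =
      U * CS_block_mat n C S * diag_block_mat [V1, mat_adjoint U1, mat_adjoint U2, V2] * Z_mat n"
    by simp
  have inv: "invertible_mat (?DA * W_mat n)" "invertible_mat (?DB * W_mat n)"
    using unitary_mat_invertible unitary_mat_mult[OF DAu unitary_W_mat] unitary_mat_mult[OF DBu unitary_W_mat]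
    by auto
  have "vec_space.rank (2 * n) A = n + vec_space.rank n S"
    unfolding mult_2 Aeq C_def[symmetric] S_def[symmetric]
    by (rule rank_cs_factors(1)[OF U mc[OF DA W] inv(1) C S])
  moreover have "vec_space.rank (2 * n) B = n + vec_space.rank n S"
    unfolding mult_2 Beq C_def[symmetric] S_def[symmetric]
    by (rule rank_cs_factors(2)[OF U mc[OF DB W] inv(2) C S])
  ultimately have common: "common_rank n A B r \<longleftrightarrow> vec_space.rank n S = r" for r
    by (auto simp: common_rank_def)
  have "vec_space.rank n S = 0 \<longleftrightarrow> S = 0\<^sub>m n n"
    using rank_eq_0_imp_zero[OF S] vec_space.rank_0I[where 'a = complex] by metis
  then have types: "separated_bc n A B \<longleftrightarrow> S = 0\<^sub>m n n"
    "mixed_bc n A B \<longleftrightarrow> 0 < vec_space.rank n S \<and> vec_space.rank n S < n"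
    "coupled_bc n A B \<longleftrightarrow> vec_space.rank n S = n"
    by (auto simp: separated_bc_def mixed_bc_def coupled_bc_def common)
  have "C * C + S * S = 1\<^sub>m n"
    unfolding C_def S_def real_diag_mult
    using cs by (intro eq_matI) (auto simp: power2_eq_square simp flip: of_real_add of_real_mult)
  moreover have "pos_semidef_mat n C" "pos_semidef_mat n S"
    unfolding C_def S_def using pos_semidef_real_diag c s by blast+
  moreover have "diagonal_mat C" "diagonal_mat S"
    unfolding C_def S_def by (rule diagonal_mat_real_diag)+
  ultimately show ?thesis
    using U V1 V2 unitary_mat_adjoint[OF U1] unitary_mat_adjoint[OF U2] factor types
    unfolding mult_2 by blast
qed

end
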